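(* Let $(x,y)$ be a standard coordinate system on $\mathbb{R}^2$. Then any closed ideal in $\mathcal{P}_0^2(\mathbb{R}^2)$ is equivalent to one of the ideals in the following list (arranged by number of generators): - 1 generator: $\{0\},\ \langle x\rangle_2,\ \langle x^2\rangle_2,\ \langle xy\rangle_2$; - 2 generators: $\langle x^2,xy\rangle_2,\ \mathcal{P}_0^2(\mathbb{R}^2)$. Moreover, any ideal in this list arises as $I^2(E)$ for some semi-algebraic set $E\subset\mathbb{R}^2$ that contains the origin, and any two different ideals in this list are non-equivalent.
   Context: Jets (used here with $m=2$, $n=2$). $\mathcal{P}^m(\mathbb{R}^n)$ is the ring of $m$-jets at the origin of $C^m$ real-valued functions on $\mathbb{R}^n$: its elements are identified with real polynomials in $n$ variables of degree at most $m$, and multiplication is polynomial multiplication followed by discarding all monomials of degree $>m$. $\mathcal{P}_0^m(\mathbb{R}^n)\subset\mathcal{P}^m(\mathbb{R}^n)$ is the set of jets vanishing at the origin. For $F\in C^m(\mathbb{R}^n)$, $J^m(F)$ is its $m$-th degree Taylor polynomial at $\vec 0$. An ideal in $\mathcal{P}_0^m(\mathbb{R}^n)$ means an ideal of the ring $\mathcal{P}^m(\mathbb{R}^n)$ contained in $\mathcal{P}_0^m(\mathbb{R}^n)$ (in particular a real linear subspace); $\langle p_1,\dots,p_t\rangle_m$ denotes the ideal of this kind generated by $p_1,\dots,p_t\in\mathcal{P}_0^m(\mathbb{R}^n)$. For $E\subset\mathbb{R}^n$ with $\vec 0\in E$, $$I^m(E):=\{J^m(F) : F\in C^m(\mathbb{R}^n),\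 F=0\text{ on }E\}.$$ Equivalence. A $C^m$-diffeomorphism $\phi:\mathbb{R}^n\to\mathbb{R}^n$ fixing the origin induces an automorphism of $\mathcal{P}_0^m(\mathbb{R}^n)$ by $p\mapsto J^m(p\circ\phi)$. Two ideals $I,I'$ in $\mathcal{P}_0^m(\mathbb{R}^n)$ are equivalent if $I'$ is the image of $I$ under such an automorphism. Allowed directions. For $\omega\in S^{n-1}$ and $\delta,r>0$ let $\Gamma(\omega,\delta,r)=\{\vec x\in\mathbb{R}^n: 0<|\vec x|<r,\ |\vec x/|\vec x|-\omega|<\delta\}$. A direction $\omega\in S^{n-1}$ is a forbidden direction of an ideal $I\lhd\mathcal{P}_0^m(\mathbb{R}^n)$ if there exist finitely many $p_1,\dots,p_L\in I$ and $c,\delta,r>0$ such that $|p_1(\vec x)|+\dots+|p_L(\vec x)|>c|\vec x|^m$ for all $\vec x\in\Gamma(\omega,\delta,r)$; otherwise it is an allowed direction. $Allow(I)\subset S^{n-1}$ is the set of allowed directions of $I$. Closed ideals. For $K\ge1$, $\rho>0$ let $\mathrm{Ann}_K(\rho)=\{\vec x\in\mathbb{R}^n:\rho/K<|\vec x|<K\rho\}$. The distance from a point to the empty set is $+\infty$. Let $I\lhd\mathcal{P}_0^m(\mathbb{R}^n)$ be an ideal and $\Omega=Allow(I)$. A jet $p\in\mathcal{P}_0^m(\mathbb{R}^n)$ is implied by $I$ if there exist a constant $A>0$ and $Q_1,\dots,Q_L\in I$ such that: for every $\epsilon>0$ there exist $\delta,r>0$ such that for every $0<\rho\le r$ there exist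 $F,S_1,\dots,S_L\in C^m(\mathrm{Ann}_4(\rho))$ with (i) $|\partial^\alpha F(\vec x)|\le\epsilon\rho^{m-|\alpha|}$ for all $\vec x\in\mathrm{Ann}_4(\rho)$, $|\alpha|\le m$; (ii) $|\partial^\alpha S_l(\vec x)|\le A\rho^{-|\alpha|}$ for all $\vec x\in\mathrm{Ann}_4(\rho)$, $|\alpha|\le m$, $1\le l\le L$; (iii) $p(\vec x)=F(\vec x)+\sum_{l=1}^L S_l(\vec x)Q_l(\vec x)$ for all $\vec x\in\mathrm{Ann}_2(\rho)$ with $\mathrm{dist}(\vec x/|\vec x|,\Omega)<\delta$. $I$ is closed (implication-closed) if every jet implied by $I$ belongs to $I$. A set is semi-algebraic if it can be described by finitely many polynomial equations and inequalities and boolean operations. *)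

theory Defs
  imports
    "HOL-Analysis.Analysis"
    "HOL-Computational_Algebra.Polynomial"
    "HOL-Algebra.Ideal"
begin

text \<open>
  Jets at the origin of functions on the plane. The plane is \<^typ>\<open>real \<times> real\<close>, whose norm is the
  Euclidean one. A polynomial in \<open>x\<close> and \<open>y\<close> is an element of \<^typ>\<open>real poly poly\<close>: a polynomial in
  the outer variable \<open>y\<close> whose coefficients are polynomials in the inner variable \<open>x\<close>.
\<close>

definition xy_coeff :: "real poly poly \<Rightarrow> nat \<Rightarrow> nat \<Rightarrow> real" where
  "xy_coeff p i j = coeff (coeff p j) i"

definition xy_monom :: "real \<Rightarrow> nat \<Rightarrow> nat \<Rightarrow> real poly poly" where
  "xy_monom c i j = monom (monom c i) j"

definition var_x :: "real poly poly" where
  "var_x = xy_monom 1 1 0"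

definition var_y :: "real poly poly" where
  "var_y = xy_monom 1 0 1"

definition xy_eval :: "real poly poly \<Rightarrow> real \<times> real \<Rightarrow> real" where
  "xy_eval p = (\<lambda>(x, y). poly (poly p [:y:]) x)"

definition jets :: "nat \<Rightarrow> real poly poly set" where
  "jets m = {p. \<forall>i j. xy_coeff p i j \<noteq> 0 \<longrightarrow> i + j \<le> m}"

definition jets0 :: "nat \<Rightarrow> real poly poly set" where
  "jets0 m = {p \<in> jets m. xy_eval p (0, 0) = 0}"

definition jet_trunc :: "nat \<Rightarrow> real poly poly \<Rightarrow> real poly poly" where
  "jet_trunc m p = (\<Sum>(i, j) \<in> {(i, j). i + j \<le> m}. xy_monom (xy_coeff p i j) i j)"

definition jet_ring :: "nat \<Rightarrow> real poly poly ring" where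
  "jet_ring m = \<lparr>carrier = jets m, mult = (\<lambda>p q. jet_trunc m (p * q)), one = 1,
                 zero = 0, add = (+)\<rparr>"

definition jet_ideal :: "nat \<Rightarrow> real poly poly set \<Rightarrow> bool" where
  "jet_ideal m I \<longleftrightarrow> ideal I (jet_ring m) \<and> I \<subseteq> jets0 m"

definition jet_span :: "nat \<Rightarrow> real poly poly set \<Rightarrow> real poly poly set" where
  "jet_span m S = genideal (jet_ring m) S"

definition partial_x :: "(real \<times> real \<Rightarrow> real) \<Rightarrow> real \<times> real \<Rightarrow> real" where
  "partial_x f v = frechet_derivative f (at v) (1, 0)"

definition partial_y :: "(real \<times> real \<Rightarrow> real) \<Rightarrow> real \<times> real \<Rightarrow> real" where
  "partial_y f v = frechet_derivative f (at v) (0, 1)"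

definition partial :: "nat \<Rightarrow> nat \<Rightarrow> (real \<times> real \<Rightarrow> real) \<Rightarrow> real \<times> real \<Rightarrow> real" where
  "partial i j f = (partial_x ^^ i) ((partial_y ^^ j) f)"

text \<open>\<open>C_on m U f\<close> says that \<open>f\<close> is of class \<open>C\<^sup>m\<close> on \<open>U\<close>; it is meant for open \<open>U\<close> only, where the
  values of \<open>f\<close> outside \<open>U\<close> are irrelevant.\<close>

primrec C_on :: "nat \<Rightarrow> (real \<times> real) set \<Rightarrow> (real \<times> real \<Rightarrow> real) \<Rightarrow> bool" where
  "C_on 0 U f \<longleftrightarrow> continuous_on U f"
| "C_on (Suc m) U f \<longleftrightarrow> f differentiable_on U \<and> C_on m U (partial_x f) \<and> C_on m U (partial_y f)"

definition taylor_jet :: "nat \<Rightarrow> (real \<times> real \<Rightarrow> real) \<Rightarrow> real poly poly" where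
  "taylor_jet m f =
     (\<Sum>(i, j) \<in> {(i, j). i + j \<le> m}. xy_monom (partial i j f (0, 0) / (fact i * fact j)) i j)"

definition vanishing_ideal :: "nat \<Rightarrow> (real \<times> real) set \<Rightarrow> real poly poly set" where
  "vanishing_ideal m E = {taylor_jet m f | f. C_on m UNIV f \<and> (\<forall>v \<in> E. f v = 0)}"

definition C_map :: "nat \<Rightarrow> (real \<times> real \<Rightarrow> real \<times> real) \<Rightarrow> bool" where
  "C_map m \<phi> \<longleftrightarrow> C_on m UNIV (fst \<circ> \<phi>) \<and> C_on m UNIV (snd \<circ> \<phi>)"

definition C_diffeo :: "nat \<Rightarrow> (real \<times> real \<Rightarrow> real \<times> real) \<Rightarrow> bool" where
  "C_diffeo m \<phi> \<longleftrightarrow> bij \<phi> \<and> C_map m \<phi> \<and> C_map m (inv_into UNIV \<phi>)"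

definition jet_equivalent :: "nat \<Rightarrow> real poly poly set \<Rightarrow> real poly poly set \<Rightarrow> bool" where
  "jet_equivalent m I I' \<longleftrightarrow>
     (\<exists>\<phi>. C_diffeo m \<phi> \<and> \<phi> (0, 0) = (0, 0) \<and> I' = (\<lambda>p. taylor_jet m (xy_eval p \<circ> \<phi>)) ` I)"

definition dir_cone :: "real \<times> real \<Rightarrow> real \<Rightarrow> real \<Rightarrow> (real \<times> real) set" where
  "dir_cone \<omega> \<delta> r = {v. 0 < norm v \<and> norm v < r \<and> norm (v /\<^sub>R norm v - \<omega>) < \<delta>}"

definition forbidden :: "nat \<Rightarrow> real poly poly set \<Rightarrow> real \<times> real \<Rightarrow> bool" where
  "forbidden m I \<omega> \<longleftrightarrow>
     (\<exists>ps c \<delta> r. set ps \<subseteq> I \<and> c > 0 \<and> \<delta> > 0 \<and> r > 0 \<and>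
        (\<forall>v \<in> dir_cone \<omega> \<delta> r. (\<Sum>p\<leftarrow>ps. \<bar>xy_eval p v\<bar>) > c * norm v ^ m))"

definition Allow :: "nat \<Rightarrow> real poly poly set \<Rightarrow> (real \<times> real) set" where
  "Allow m I = {\<omega> \<in> sphere 0 1. \<not> forbidden m I \<omega>}"

definition Ann :: "real \<Rightarrow> real \<Rightarrow> (real \<times> real) set" where
  "Ann K \<rho> = {v. \<rho> / K < norm v \<and> norm v < K * \<rho>}"

text \<open>The distance to the empty set has to be \<open>\<infinity>\<close>, whereas \<^const>\<open>infdist\<close> makes it \<open>0\<close>.\<close>

definition dist_to :: "real \<times> real \<Rightarrow> (real \<times> real) set \<Rightarrow> ereal" where
  "dist_to v S = (if S = {} then \<infinity> else ereal (infdist v S))"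

definition implied :: "nat \<Rightarrow> real poly poly set \<Rightarrow> real poly poly \<Rightarrow> bool" where
  "implied m I p \<longleftrightarrow>
     (\<exists>A Qs. A > 0 \<and> set Qs \<subseteq> I \<and>
       (\<forall>\<epsilon>>0. \<exists>\<delta> r. \<delta> > 0 \<and> r > 0 \<and>
         (\<forall>\<rho>. 0 < \<rho> \<and> \<rho> \<le> r \<longrightarrow>
           (\<exists>F S. C_on m (Ann 4 \<rho>) F \<and> (\<forall>l<length Qs. C_on m (Ann 4 \<rho>) (S l)) \<and>
             (\<forall>v \<in> Ann 4 \<rho>. \<forall>i j. i + j \<le> m \<longrightarrow>
                \<bar>partial i j F v\<bar> \<le> \<epsilon> * \<rho> ^ (m - (i + j))) \<and>
             (\<forall>v \<in> Ann 4 \<rho>. \<forall>i j. i + j \<le> m \<longrightarrow> (\<forall>l<length Qs.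
                \<bar>partial i j (S l) v\<bar> \<le> A / \<rho> ^ (i + j))) \<and>
             (\<forall>v \<in> Ann 2 \<rho>. dist_to (v /\<^sub>R norm v) (Allow m I) < ereal \<delta> \<longrightarrow>
                xy_eval p v = F v + (\<Sum>l<length Qs. S l v * xy_eval (Qs ! l) v))))))"

definition implication_closed :: "nat \<Rightarrow> real poly poly set \<Rightarrow> bool" where
  "implication_closed m I \<longleftrightarrow> (\<forall>p \<in> jets0 m. implied m I p \<longrightarrow> p \<in> I)"

inductive semialgebraic :: "(real \<times> real) set \<Rightarrow> bool" where
  eq: "semialgebraic {v. xy_eval p v = 0}"
| gt: "semialgebraic {v. xy_eval p v > 0}"
| compl: "semialgebraic A \<Longrightarrow> semialgebraic (- A)"
| union: "semialgebraic A \<Longrightarrow> semialgebraic B \<Longrightarrow> semialgebraic (A \<union> B)"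

end

theory Submission
  imports Defs
begin

text \<open>
  An ideal \<open>I\<close> without allowed directions implies every jet vacuously, since the distance to the empty set
  is infinite. A direction at which some quadratic form in \<open>I\<close> does not vanish is forbidden, by
  homogeneity. So a closed ideal other than the ideal of all jets vanishing at the origin has a direction
  at which all its quadratic forms vanish; this is rotated to the \<open>y\<close>-axis. Then all quadratic forms in
  \<open>I\<close> are divisible by \<open>x\<close>. If \<open>I\<close> contains a jet \<open>p\<close> with non-zero linear part, then \<open>x p\<close> and \<open>y p\<close> force
  \<open>p = x + c y\<^sup>2 + \<dots>\<close> up to scaling, and the substitution of \<open>x - c y\<^sup>2\<close> for \<open>x\<close> turns \<open>I\<close> into
  \<open>\<langle>x\<rangle>\<close>. Otherwise \<open>I\<close> is \<open>x W\<close> for a space \<open>W\<close> of linear forms, which leaves four cases.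

  The normal forms are \<open>I\<^sup>2(E)\<close> for, in the order of the list: the plane, the \<open>y\<close>-axis, the union of the
  \<open>y\<close>-axis and the parabola \<open>x = y\<^sup>2\<close>, the union of the axes, the half cusp \<open>x\<^sup>2 = y\<^sup>3\<close>, \<open>x \<ge> 0\<close> (where
  \<open>x y\<close> agrees with the \<open>C\<^sup>2\<close> function \<open>y\<^sup>2 \<surd>\<bar>y\<bar>\<close>, whose jet is zero), and the origin. They are told apart by
  linear parts and by the degenerate quadratic forms they contain, as the linear part of a diffeomorphism
  is invertible.
\<close>

section \<open>The ring of jets\<close>

lemma xy_coeff_0 [simp]: "xy_coeff 0 i j = 0"
  by (simp add: xy_coeff_def)

lemma xy_coeff_add [simp]: "xy_coeff (p + q) i j = xy_coeff p i j + xy_coeff q i j"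
  by (simp add: xy_coeff_def)

lemma xy_coeff_sum [simp]: "xy_coeff (sum f A) i j = (\<Sum>x\<in>A. xy_coeff (f x) i j)"
  by (simp add: xy_coeff_def coeff_sum)

lemma xy_coeff_monom: "xy_coeff (xy_monom c k l) i j = (if i = k \<and> j = l then c else 0)"
  by (simp add: xy_coeff_def xy_monom_def)

lemma xy_coeff_mult:
  "xy_coeff (p * q) i j = (\<Sum>l\<le>j. \<Sum>k\<le>i. xy_coeff p k l * xy_coeff q (i - k) (j - l))"
  by (simp add: xy_coeff_def coeff_mult coeff_sum)

lemma xy_poly_eqI: "(\<And>i j. xy_coeff p i j = xy_coeff q i j) \<Longrightarrow> p = q"
  by (simp add: xy_coeff_def poly_eq_iff)

lemma xy_monom_mult: "xy_monom a i j * xy_monom b k l = xy_monom (a * b) (i + k) (j + l)"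
  by (simp add: xy_monom_def mult_monom)

lemma xy_monom_0 [simp]: "xy_monom 0 i j = 0"
  by (simp add: xy_monom_def)

lemma xy_monom_add: "xy_monom a i j + xy_monom b i j = xy_monom (a + b) i j"
  by (simp add: xy_monom_def add_monom)

lemma xy_eval_0 [simp]: "xy_eval 0 v = 0"
  by (simp add: xy_eval_def split: prod.split)

lemma xy_eval_add [simp]: "xy_eval (p + q) v = xy_eval p v + xy_eval q v"
  by (simp add: xy_eval_def split: prod.split)

lemma xy_eval_monom [simp]: "xy_eval (xy_monom c i j) (x, y) = c * x ^ i * y ^ j"
proof -
  have "[:y:] ^ j = [:y ^ j:]"
    by (induction j) (auto simp: one_pCons)
  then show ?thesis
    by (simp add: xy_eval_def xy_monom_def poly_monom mult.commute[of _ "[:y ^ j:]"])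
qed

lemma finite_degree_le: "finite {(i, j). i + j \<le> (m::nat)}"
  by (rule finite_subset[of _ "{..m} \<times> {..m}"]) auto

lemma xy_coeff_jet_trunc: "xy_coeff (jet_trunc m p) i j = (if i + j \<le> m then xy_coeff p i j else 0)"
proof -
  have "xy_coeff (jet_trunc m p) i j =
      (\<Sum>x\<in>{(i, j). i + j \<le> m}. if x = (i, j) then xy_coeff p i j else 0)"
    by (auto simp: jet_trunc_def xy_coeff_monom case_prod_beta intro!: sum.cong)
  also have "\<dots> = (if i + j \<le> m then xy_coeff p i j else 0)"
    by (simp add: finite_degree_le)
  finally show ?thesis .
qed

lemma jet_trunc_in_jets [simp]: "jet_trunc m p \<in> jets m"
  by (simp add: jets_def xy_coeff_jet_trunc)

lemma jet_trunc_eq: "p \<in> jets m \<Longrightarrow> jet_trunc m p = p"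
  by (rule xy_poly_eqI) (auto simp: jets_def xy_coeff_jet_trunc)

lemma jet_trunc_add: "jet_trunc m (p + q) = jet_trunc m p + jet_trunc m q"
  by (rule xy_poly_eqI) (auto simp: xy_coeff_jet_trunc)

lemma jet_trunc_monom: "jet_trunc m (xy_monom c i j) = (if i + j \<le> m then xy_monom c i j else 0)"
  by (rule xy_poly_eqI) (auto simp: xy_coeff_jet_trunc xy_coeff_monom)

text \<open>A coefficient of total degree at most \<open>m\<close> in a product involves only
  coefficients of total degree at most \<open>m\<close> in the factors. This makes the truncated
  product associative.\<close>

lemma jet_trunc_mult_trunc: "jet_trunc m (jet_trunc m p * q) = jet_trunc m (p * q)"
  by (rule xy_poly_eqI) (auto simp: xy_coeff_jet_trunc xy_coeff_mult intro!: sum.cong)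

lemma jet_trunc_mult_trunc_right: "jet_trunc m (p * jet_trunc m q) = jet_trunc m (p * q)"
  using jet_trunc_mult_trunc[of m q p] by (simp add: mult.commute)

lemma jets_add: "p \<in> jets m \<Longrightarrow> q \<in> jets m \<Longrightarrow> p + q \<in> jets m"
  by (auto simp: jets_def) (metis add.right_neutral)

lemma jets_const: "xy_monom c 0 0 \<in> jets m"
  by (simp add: jets_def xy_coeff_monom)

lemma xy_monom_one: "xy_monom 1 0 0 = 1"
  by (simp add: xy_monom_def monom_0 one_pCons)

section \<open>The jet ring and its ideals\<close>

lemma jet_ring_ring: "ring (jet_ring m)"
proof (rule ringI)
  show "abelian_group (jet_ring m)"
  proof (rule abelian_groupI)
    fix p assume "p \<in> carrier (jet_ring m)"
    then show "\<exists>q\<in>carrier (jet_ring m). q \<oplus>\<^bsub>jet_ring m\<^esub> p = \<zero>\<^bsub>jet_ring m\<^esub>"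
      by (intro bexI[of _ "- p"]) (auto simp: jet_ring_def jets_def xy_coeff_def)
  qed (auto simp: jet_ring_def jets_add add_ac, simp add: jets_def)
  have "1 \<in> jets m" 
    using jets_const[of 1 m] by (simp add: xy_monom_one)
  then show "monoid (jet_ring m)"
    by (intro monoidI)
      (auto simp: jet_ring_def jet_trunc_eq jet_trunc_mult_trunc jet_trunc_mult_trunc_right mult_ac)
qed (auto simp: jet_ring_def distrib_left distrib_right jet_trunc_add)

text \<open>Closure under additive inverses follows from \<open>mult\<close>, because
  \<open>- p\<close> is the product of \<open>p\<close> with the constant jet -1.\<close>

lemma ideal_jet_ringI:
  assumes "I \<subseteq> jets m" "0 \<in> I"
    and add: "\<And>p q. p \<in> I \<Longrightarrow> q \<in> I \<Longrightarrow> p + q \<in> I"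
    and mult: "\<And>p q. p \<in> jets m \<Longrightarrow> q \<in> I \<Longrightarrow> jet_trunc m (p * q) \<in> I"
  shows "ideal I (jet_ring m)"
proof (rule idealI[OF jet_ring_ring])
  have minus: "- p \<in> I" if "p \<in> I" for p
  proof -
    have "xy_monom (-1) 0 0 = - 1"
      by (simp add: xy_monom_def monom_0 one_pCons)
    moreover have "- p \<in> jets m"
      using that assms(1) by (auto simp: jets_def xy_coeff_def)
    ultimately have "- p = jet_trunc m (xy_monom (-1) 0 0 * p)"
      by (simp add: jet_trunc_eq)
    then show ?thesis
      using mult[OF jets_const that] by metis
  qed
  \<comment> \<open>The inverse in \<open>add_monoid\<close> is given by a description; uniqueness
    of inverses in the ring identifies it with unary minus.\<close>
  have inv: "inv\<^bsub>add_monoid (jet_ring m)\<^esub> p = - p" if "p \<in> I" for p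
  proof -
    interpret ring "jet_ring m" by (rule jet_ring_ring)
    have "\<ominus>\<^bsub>jet_ring m\<^esub> p = - p"
      by (rule minus_equality) (use that minus[OF that] assms(1) in \<open>auto simp: jet_ring_def\<close>)
    then show ?thesis by (simp add: a_inv_def)
  qed
  show "subgroup I (add_monoid (jet_ring m))"
  proof (rule subgroup.intro)
    show "inv\<^bsub>add_monoid (jet_ring m)\<^esub> p \<in> I" if "p \<in> I" for p
      using that by (simp only: inv minus)
  qed (use assms in \<open>auto simp: jet_ring_def\<close>)
next
  fix p q assume "q \<in> I" "p \<in> carrier (jet_ring m)"
  with mult show "p \<otimes>\<^bsub>jet_ring m\<^esub> q \<in> I" "q \<otimes>\<^bsub>jet_ring m\<^esub> p \<in> I"
    by (simp_all add: jet_ring_def mult.commute[of q])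
qed

lemma ideal_jet_ringD:
  assumes "ideal I (jet_ring m)"
  shows "0 \<in> I" and "\<And>p q. p \<in> I \<Longrightarrow> q \<in> I \<Longrightarrow> p + q \<in> I"
    and "\<And>p q. p \<in> jets m \<Longrightarrow> q \<in> I \<Longrightarrow> jet_trunc m (p * q) \<in> I"
proof -
  interpret ideal I "jet_ring m" by fact
  show "0 \<in> I" 
    using additive_subgroup.zero_closed[OF is_additive_subgroup] by (simp add: jet_ring_def)
  show "\<And>p q. p \<in> I \<Longrightarrow> q \<in> I \<Longrightarrow> p + q \<in> I"
    using additive_subgroup.a_closed[OF is_additive_subgroup] by (simp add: jet_ring_def)
  show "\<And>p q. p \<in> jets m \<Longrightarrow> q \<in> I \<Longrightarrow> jet_trunc m (p * q) \<in> I"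
    using I_l_closed by (simp add: jet_ring_def)
qed

section \<open>Second-order jets in five real coordinates\<close>

definition quad_jet :: "real \<Rightarrow> real \<Rightarrow> real \<Rightarrow> real \<Rightarrow> real \<Rightarrow> real poly poly" where
  "quad_jet a b c d e =
     xy_monom a 1 0 + xy_monom b 0 1 + xy_monom c 2 0 + xy_monom d 1 1 + xy_monom e 0 2"

lemma xy_coeff_quad_jet:
  "xy_coeff (quad_jet a b c d e) i j =
     (if i = 1 \<and> j = 0 then a else if i = 0 \<and> j = 1 then b else if i = 2 \<and> j = 0 then c
      else if i = 1 \<and> j = 1 then d else if i = 0 \<and> j = 2 then e else 0)"
  by (simp add: quad_jet_def xy_coeff_monom)

lemma quad_jet_eq_iff [simp]:
  "quad_jet a b c d e = quad_jet a' b' c' d' e' \<longleftrightarrow> a = a' \<and> b = b' \<and> c = c' \<and> d = d' \<and> e = e'"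
proof
  assume eq: "quad_jet a b c d e = quad_jet a' b' c' d' e'"
  have "xy_coeff (quad_jet a b c d e) i j = xy_coeff (quad_jet a' b' c' d' e') i j" for i j
    by (simp add: eq)
  from this[of 1 0] this[of 0 1] this[of 2 0] this[of 1 1] this[of 0 2]
  show "a = a' \<and> b = b' \<and> c = c' \<and> d = d' \<and> e = e'"
    by (simp add: xy_coeff_quad_jet)
qed simp

lemma quad_jet_add:
  "quad_jet a b c d e + quad_jet a' b' c' d' e' =
     quad_jet (a + a') (b + b') (c + c') (d + d') (e + e')"
  by (rule xy_poly_eqI) (simp add: xy_coeff_quad_jet)

lemma quad_jet_0: "quad_jet 0 0 0 0 0 = 0"
  by (simp add: quad_jet_def)

lemma quad_jet_eq_0_iff [simp]:
  "quad_jet a b c d e = 0 \<longleftrightarrow> a = 0 \<and> b = 0 \<and> c = 0 \<and> d = 0 \<and> e = 0"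
  using quad_jet_eq_iff[of a b c d e 0 0 0 0 0] by (simp only: quad_jet_0)

lemma xy_eval_quad_jet [simp]:
  "xy_eval (quad_jet a b c d e) (x, y) = a * x + b * y + c * x\<^sup>2 + d * x * y + e * y\<^sup>2"
  by (simp add: quad_jet_def)

lemma jets2_eq: "jets 2 = {xy_monom k 0 0 + quad_jet a b c d e | k a b c d e. True}"
proof safe
  fix p assume p: "p \<in> jets 2"
  have "p = xy_monom (xy_coeff p 0 0) 0 0 + quad_jet (xy_coeff p 1 0) (xy_coeff p 0 1)
      (xy_coeff p 2 0) (xy_coeff p 1 1) (xy_coeff p 0 2)"
  proof (rule xy_poly_eqI)
    fix i j
    have "xy_coeff p i j = 0" if "i + j > 2"
      using p that by (auto simp: jets_def not_less[symmetric])
    moreover have "i + j > 2 \<or> (i, j) \<in> {(0,0), (1,0), (0,1), (2,0), (1,1), (0,2)}"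
      by auto
    ultimately show "xy_coeff p i j = xy_coeff (xy_monom (xy_coeff p 0 0) 0 0 +
        quad_jet (xy_coeff p 1 0) (xy_coeff p 0 1)
          (xy_coeff p 2 0) (xy_coeff p 1 1) (xy_coeff p 0 2)) i j"
      by (auto simp: xy_coeff_quad_jet xy_coeff_monom)
  qed
  then show "\<exists>k a b c d e. p = xy_monom k 0 0 + quad_jet a b c d e \<and> True"
    by blast
next
  fix k a b c d e
  show "xy_monom k 0 0 + quad_jet a b c d e \<in> jets 2"
    by (auto simp: jets_def xy_coeff_quad_jet xy_coeff_monom split: if_splits)
qed

lemma jets0_2_eq: "jets0 2 = {quad_jet a b c d e | a b c d e. True}"
  by (force simp: jets0_def jets2_eq intro: exI[of _ 0])

lemma jets0_2_cases:
  assumes "p \<in> jets0 2"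
  obtains a b c d e where "p = quad_jet a b c d e"
  using assms by (auto simp: jets0_2_eq)

lemma quad_jet_in_jets0 [simp]: "quad_jet a b c d e \<in> jets0 2"
  by (auto simp: jets0_2_eq)

text \<open>The second factor has no constant term, so the quadratic part \<open>c\<close>,
  \<open>d\<close>, \<open>e\<close> of the multiplier only produces terms of degree at least
  three.\<close>

lemma jet_trunc_mult_quad_jet:
  "jet_trunc 2 ((xy_monom k 0 0 + quad_jet a b c d e) * quad_jet a' b' c' d' e') =
     quad_jet (k * a') (k * b') (k * c' + a * a') (k * d' + a * b' + b * a') (k * e' + b * b')"
proof -
  have 2: "Suc (Suc 0) = 2" by simp
  show ?thesis
    unfolding quad_jet_def
    by (simp add: distrib_left distrib_right xy_monom_mult jet_trunc_add jet_trunc_monom 2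
        flip: xy_monom_add)
qed

lemma jet_ideal_zero: "jet_ideal 2 I \<Longrightarrow> quad_jet 0 0 0 0 0 \<in> I"
  using ideal_jet_ringD(1) by (auto simp: jet_ideal_def quad_jet_0)

lemma jet_ideal_add:
  "jet_ideal 2 I \<Longrightarrow> quad_jet a b c d e \<in> I \<Longrightarrow> quad_jet a' b' c' d' e' \<in> I \<Longrightarrow>
     quad_jet (a + a') (b + b') (c + c') (d + d') (e + e') \<in> I"
  using ideal_jet_ringD(2) by (force simp: jet_ideal_def simp flip: quad_jet_add)

text \<open>Closure under the multiplier \<open>k + l x + m y\<close>; a quadratic part of the
  multiplier would be truncated, so these are all multiples of a jet without constant term.\<close>

lemma jet_ideal_mult:
  assumes "ideal I (jet_ring 2)" "quad_jet a b c d e \<in> I"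
  shows "quad_jet (k * a) (k * b) (k * c + l * a) (k * d + l * b + m * a) (k * e + m * b) \<in> I"
proof -
  have "xy_monom k 0 0 + quad_jet l m 0 0 0 \<in> jets 2"
    unfolding jets2_eq by blast
  from ideal_jet_ringD(3)[OF assms(1) this assms(2)] show ?thesis
    by (simp add: jet_trunc_mult_quad_jet)
qed

section \<open>The ideals of the list in coordinates\<close>

lemma var_x_eq: "var_x = quad_jet 1 0 0 0 0"
  and var_x2_eq: "var_x ^ 2 = quad_jet 0 0 1 0 0"
  and var_xy_eq: "var_x * var_y = quad_jet 0 0 0 1 0"
  by (simp_all add: var_x_def var_y_def quad_jet_def power2_eq_square xy_monom_mult numeral_2_eq_2)

lemma jet_span_eqI:
  assumes "ideal I (jet_ring m)" "S \<subseteq> I" "\<And>I'. ideal I' (jet_ring m) \<Longrightarrow> S \<subseteq> I' \<Longrightarrow> I \<subseteq> I'"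
  shows "jet_span m S = I"
  using assms unfolding jet_span_def genideal_def by blast

text \<open>The third hypothesis covers every multiplier, since only its constant term
  \<open>k\<close> and its linear part \<open>l x + m y\<close> survive truncation.\<close>

lemma ideal_quad_jetI:
  assumes "P 0 0 0 0 0"
    and "\<And>a b c d e a' b' c' d' e'. P a b c d e \<Longrightarrow> P a' b' c' d' e' \<Longrightarrow>
           P (a + a') (b + b') (c + c') (d + d') (e + e')"
    and "\<And>a b c d e k l m. P a b c d e \<Longrightarrow>
           P (k * a) (k * b) (k * c + l * a) (k * d + l * b + m * a) (k * e + m * b)"
  shows "ideal {quad_jet a b c d e | a b c d e. P a b c d e} (jet_ring 2)"
proof (rule ideal_jet_ringI)
  show "{quad_jet a b c d e | a b c d e. P a b c d e} \<subseteq> jets 2"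
    using quad_jet_in_jets0 by (auto simp: jets0_def)
  show "0 \<in> {quad_jet a b c d e | a b c d e. P a b c d e}"
    using assms(1) quad_jet_0 by force
next
  fix p q assume "p \<in> {quad_jet a b c d e | a b c d e. P a b c d e}"
    "q \<in> {quad_jet a b c d e | a b c d e. P a b c d e}"
  then show "p + q \<in> {quad_jet a b c d e | a b c d e. P a b c d e}"
    using assms(2) by (auto simp: quad_jet_add)
next
  fix p q assume "p \<in> jets 2" "q \<in> {quad_jet a b c d e | a b c d e. P a b c d e}"
  then show "jet_trunc 2 (p * q) \<in> {quad_jet a b c d e | a b c d e. P a b c d e}"
    using assms(3) by (auto simp: jets2_eq jet_trunc_mult_quad_jet)
qed

lemma jet_span_x: "jet_span 2 {var_x} = {quad_jet a 0 c d 0 | a c d. True}"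
proof -
  have "jet_span 2 {var_x} = {quad_jet a b c d e | a b c d e. b = 0 \<and> e = 0}"
  proof (rule jet_span_eqI)
    fix I assume "ideal I (jet_ring 2)" "{var_x} \<subseteq> I"
    then have "quad_jet k 0 l m 0 \<in> I" for k l m
      using jet_ideal_mult[of I 1 0 0 0 0 k l m] by (auto simp: var_x_eq)
    then show "{quad_jet a b c d e | a b c d e. b = 0 \<and> e = 0} \<subseteq> I" by auto
  qed (rule ideal_quad_jetI, auto simp: var_x_eq)
  then show ?thesis by auto
qed

lemma jet_span_x2: "jet_span 2 {var_x ^ 2} = {quad_jet 0 0 c 0 0 | c. True}"
proof -
  have "jet_span 2 {var_x ^ 2} = {quad_jet a b c d e | a b c d e. a = 0 \<and> b = 0 \<and> d = 0 \<and> e = 0}"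
  proof (rule jet_span_eqI)
    fix I assume "ideal I (jet_ring 2)" "{var_x ^ 2} \<subseteq> I"
    then have "quad_jet 0 0 k 0 0 \<in> I" for k
      using jet_ideal_mult[of I 0 0 1 0 0 k] by (auto simp: var_x2_eq)
    then show "{quad_jet a b c d e | a b c d e. a = 0 \<and> b = 0 \<and> d = 0 \<and> e = 0} \<subseteq> I" by auto
  qed (rule ideal_quad_jetI, auto simp: var_x2_eq)
  then show ?thesis by auto
qed

lemma jet_span_xy: "jet_span 2 {var_x * var_y} = {quad_jet 0 0 0 d 0 | d. True}"
proof -
  have "jet_span 2 {var_x * var_y} =
      {quad_jet a b c d e | a b c d e. a = 0 \<and> b = 0 \<and> c = 0 \<and> e = 0}"
  proof (rule jet_span_eqI)
    fix I assume "ideal I (jet_ring 2)" "{var_x * var_y} \<subseteq> I"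
    then have "quad_jet 0 0 0 k 0 \<in> I" for k
      using jet_ideal_mult[of I 0 0 0 1 0 k] by (auto simp: var_xy_eq)
    then show "{quad_jet a b c d e | a b c d e. a = 0 \<and> b = 0 \<and> c = 0 \<and> e = 0} \<subseteq> I" by auto
  qed (rule ideal_quad_jetI, auto simp: var_xy_eq)
  then show ?thesis by auto
qed

lemma jet_span_x2_xy: "jet_span 2 {var_x ^ 2, var_x * var_y} = {quad_jet 0 0 c d 0 | c d. True}"
proof -
  have "jet_span 2 {var_x ^ 2, var_x * var_y} =
      {quad_jet a b c d e | a b c d e. a = 0 \<and> b = 0 \<and> e = 0}"
  proof (rule jet_span_eqI)
    fix I assume I: "ideal I (jet_ring 2)" "{var_x ^ 2, var_x * var_y} \<subseteq> I"
    then have "quad_jet 0 0 c 0 0 \<in> I" "quad_jet 0 0 0 d 0 \<in> I" for c d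
      using jet_ideal_mult[of I 0 0 1 0 0 c] jet_ideal_mult[of I 0 0 0 1 0 d]
      by (auto simp: var_x2_eq var_xy_eq)
    from ideal_jet_ringD(2)[OF I(1) this]
    have "quad_jet 0 0 c d 0 \<in> I" for c d by (simp add: quad_jet_add)
    then show "{quad_jet a b c d e | a b c d e. a = 0 \<and> b = 0 \<and> e = 0} \<subseteq> I" by auto
  qed (rule ideal_quad_jetI, auto simp: var_x2_eq var_xy_eq)
  then show ?thesis by auto
qed

section \<open>Partial derivatives and second order jets\<close>

lemma partial_x_eq: "(f has_derivative f') (at v) \<Longrightarrow> partial_x f v = f' (1, 0)"
  and partial_y_eq: "(f has_derivative f') (at v) \<Longrightarrow> partial_y f v = f' (0, 1)"
  by (simp_all add: partial_x_def partial_y_def flip: frechet_derivative_at)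

lemma has_derivative_partials:
  assumes "f differentiable (at v)"
  shows "(f has_derivative (\<lambda>h. partial_x f v * fst h + partial_y f v * snd h)) (at v)"
proof -
  obtain f' where f': "(f has_derivative f') (at v)"
    using assms by (auto simp: differentiable_def)
  interpret bounded_linear f' using f' by (rule has_derivative_bounded_linear)
  have "f' h = partial_x f v * fst h + partial_y f v * snd h" for h
  proof -
    have "f' h = f' (fst h *\<^sub>R (1, 0) + snd h *\<^sub>R (0, 1))" by simp
    also have "\<dots> = fst h *\<^sub>R f' (1, 0) + snd h *\<^sub>R f' (0, 1)"
      by (simp only: add scaleR)
    finally show ?thesis
      by (simp add: partial_x_eq[OF f'] partial_y_eq[OF f'])
  qed
  then have "f' = (\<lambda>h. partial_x f v * fst h + partial_y f v * snd h)" by (rule ext)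
  with f' show ?thesis by simp
qed

lemma partial_const [simp]: "partial_x (\<lambda>_. c) = (\<lambda>_. 0)" "partial_y (\<lambda>_. c) = (\<lambda>_. 0)"
  by (simp_all add: fun_eq_iff partial_x_def partial_y_def)

lemma partial_fst [simp]: "partial_x fst = (\<lambda>_. 1)" "partial_y fst = (\<lambda>_. 0)"
  using partial_x_eq[OF has_derivative_fst[OF has_derivative_ident]]
    partial_y_eq[OF has_derivative_fst[OF has_derivative_ident]] by (simp_all add: fun_eq_iff)

lemma partial_snd [simp]: "partial_x snd = (\<lambda>_. 0)" "partial_y snd = (\<lambda>_. 1)"
  using partial_x_eq[OF has_derivative_snd[OF has_derivative_ident]]
    partial_y_eq[OF has_derivative_snd[OF has_derivative_ident]] by (simp_all add: fun_eq_iff)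

text \<open>An equation between functions rather than between values at a point, so that it rewrites
  under a further partial derivative.\<close>

lemma partial_add:
  assumes "f differentiable_on UNIV" "g differentiable_on UNIV"
  shows "partial_x (\<lambda>v. f v + g v) = (\<lambda>v. partial_x f v + partial_x g v)"
    and "partial_y (\<lambda>v. f v + g v) = (\<lambda>v. partial_y f v + partial_y g v)"
proof -
  have "((\<lambda>v. f v + g v) has_derivative
      (\<lambda>h. (partial_x f v * fst h + partial_y f v * snd h) +
           (partial_x g v * fst h + partial_y g v * snd h))) (at v)" for v
    by (intro has_derivative_add has_derivative_partials; use assms in \<open>simp only: differentiable_on_def UNIV_I ball_UNIV\<close>)
  note partial_x_eq[OF this] partial_y_eq[OF this]
  then show "partial_x (\<lambda>v. f v + g v) = (\<lambda>v. partial_x f v + partial_x g v)"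
    and "partial_y (\<lambda>v. f v + g v) = (\<lambda>v. partial_y f v + partial_y g v)"
    by (simp_all add: fun_eq_iff)
qed

lemma partial_mult:
  assumes "f differentiable_on UNIV" "g differentiable_on UNIV"
  shows "partial_x (\<lambda>v. f v * g v) = (\<lambda>v. f v * partial_x g v + partial_x f v * g v)"
    and "partial_y (\<lambda>v. f v * g v) = (\<lambda>v. f v * partial_y g v + partial_y f v * g v)"
proof -
  have "((\<lambda>v. f v * g v) has_derivative
      (\<lambda>h. f v * (partial_x g v * fst h + partial_y g v * snd h) +
           (partial_x f v * fst h + partial_y f v * snd h) * g v)) (at v)" for v
    by (intro has_derivative_mult has_derivative_partials; use assms in \<open>simp only: differentiable_on_def UNIV_I ball_UNIV\<close>)
  note partial_x_eq[OF this] partial_y_eq[OF this]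
  then show "partial_x (\<lambda>v. f v * g v) = (\<lambda>v. f v * partial_x g v + partial_x f v * g v)"
    and "partial_y (\<lambda>v. f v * g v) = (\<lambda>v. f v * partial_y g v + partial_y f v * g v)"
    by (simp_all add: fun_eq_iff)
qed

section \<open>Sums and products of functions of class C^m\<close>

lemma C_on_SucD: "C_on (Suc m) U f \<Longrightarrow> C_on m U f"
proof (induction m arbitrary: f)
  case 0
  then show ?case by (simp add: differentiable_imp_continuous_on)
next
  case (Suc m)
  have "f differentiable_on U" "C_on m U (partial_x f)" "C_on m U (partial_y f)"
    using Suc.prems Suc.IH[of "partial_x f"] Suc.IH[of "partial_y f"] by simp_all
  then show ?case by simp
qed

lemma C_on_const: "C_on m U (\<lambda>_. c)"
  by (induction m arbitrary: c) simp_all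

lemma C_on_add:
  "C_on m UNIV f \<Longrightarrow> C_on m UNIV g \<Longrightarrow> C_on m UNIV (\<lambda>v. f v + g v)"
proof (induction m arbitrary: f g)
  case 0
  then show ?case by (simp add: continuous_on_add)
next
  case (Suc m)
  then have "f differentiable_on UNIV" "g differentiable_on UNIV" by simp_all
  note partial_add[OF this] differentiable_on_add[OF this]
  with Suc show ?case by simp
qed

lemma C_on_mult:
  "C_on m UNIV f \<Longrightarrow> C_on m UNIV g \<Longrightarrow> C_on m UNIV (\<lambda>v. f v * g v)"
proof (induction m arbitrary: f g)
  case 0
  then show ?case by (simp add: continuous_on_mult)
next
  case (Suc m)
  then have "f differentiable_on UNIV" "g differentiable_on UNIV" by simp_all
  note partial_mult[OF this] differentiable_on_mult[OF this]
  \<comment> \<open>The product rule multiplies a derivative of one factor by the other factor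
    itself, which therefore has to be known to be of the lower class \<open>m\<close> as
    well.\<close>
  moreover have "C_on m UNIV f" "C_on m UNIV g"
    using Suc.prems by (blast dest: C_on_SucD)+
  ultimately show ?case
    using Suc by (simp add: C_on_add)
qed

lemma C_on_fst: "C_on m U fst" and C_on_snd: "C_on m U snd"
proof -
  have "fst differentiable_on U" "snd differentiable_on U"
    by (simp_all add: linear_imp_differentiable_on linear_fst linear_snd)
  then show "C_on m U fst" "C_on m U snd"
    by (cases m; simp add: C_on_const differentiable_imp_continuous_on)+
qed

text \<open>A relational form of \<open>taylor_jet 2 f = quad_jet a b c d e\<close> for functions
  vanishing at the origin. It carries the class C^2 along, so that jets of composite expressions can
  be assembled by resolution. The mixed derivative is taken in the order used by
  \<open>partial 1 1\<close>.\<close>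

definition has_quad_jet ::
  "(real \<times> real \<Rightarrow> real) \<Rightarrow> real \<Rightarrow> real \<Rightarrow> real \<Rightarrow> real \<Rightarrow> real \<Rightarrow> bool" where
  "has_quad_jet f a b c d e \<longleftrightarrow> C_on 2 UNIV f \<and> f (0, 0) = 0 \<and>
     partial_x f (0, 0) = a \<and> partial_y f (0, 0) = b \<and>
     partial_x (partial_x f) (0, 0) = 2 * c \<and> partial_x (partial_y f) (0, 0) = d \<and>
     partial_y (partial_y f) (0, 0) = 2 * e"

lemma C_on_2_iff:
  "C_on 2 U f \<longleftrightarrow> f differentiable_on U \<and>
     partial_x f differentiable_on U \<and> partial_y f differentiable_on U \<and>
     continuous_on U (partial_x (partial_x f)) \<and> continuous_on U (partial_y (partial_x f)) \<and>
     continuous_on U (partial_x (partial_y f)) \<and> continuous_on U (partial_y (partial_y f))"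
  by (auto simp: numeral_2_eq_2)

lemma taylor_jet_2:
  assumes "f (0, 0) = 0"
  shows "taylor_jet 2 f = quad_jet (partial_x f (0, 0)) (partial_y f (0, 0))
    (partial_x (partial_x f) (0, 0) / 2) (partial_x (partial_y f) (0, 0))
    (partial_y (partial_y f) (0, 0) / 2)"
proof -
  have "{(i, j). i + j \<le> (2::nat)} = {(0,0), (1,0), (0,1), (2,0), (1,1), (0,2)}"
    by auto
  then show ?thesis
    using assms by (simp add: taylor_jet_def partial_def quad_jet_def numeral_2_eq_2)
qed

lemma has_quad_jet_taylor: "has_quad_jet f a b c d e \<Longrightarrow> taylor_jet 2 f = quad_jet a b c d e"
  by (simp add: has_quad_jet_def taylor_jet_2)

lemma has_quad_jet_exists:
  assumes "C_on 2 UNIV f" "f (0, 0) = 0"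
  obtains a b c d e where "has_quad_jet f a b c d e"
proof
  show "has_quad_jet f (partial_x f (0, 0)) (partial_y f (0, 0))
    (partial_x (partial_x f) (0, 0) / 2) (partial_x (partial_y f) (0, 0))
    (partial_y (partial_y f) (0, 0) / 2)"
    using assms by (simp add: has_quad_jet_def)
qed

lemma has_quad_jet_zero: "has_quad_jet (\<lambda>_. 0) 0 0 0 0 0"
  by (simp add: has_quad_jet_def C_on_const)

lemma has_quad_jet_fst: "has_quad_jet fst 1 0 0 0 0"
  and has_quad_jet_snd: "has_quad_jet snd 0 1 0 0 0"
  by (simp_all add: has_quad_jet_def C_on_fst C_on_snd)

lemma has_quad_jet_differentiable:
  assumes "has_quad_jet f a b c d e"
  shows "f differentiable_on UNIV" "partial_x f differentiable_on UNIV"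
    "partial_y f differentiable_on UNIV"
  using assms by (simp_all add: has_quad_jet_def C_on_2_iff)

lemma has_quad_jet_add:
  assumes "has_quad_jet f a b c d e" "has_quad_jet g a' b' c' d' e'"
  shows "has_quad_jet (\<lambda>v. f v + g v) (a + a') (b + b') (c + c') (d + d') (e + e')"
proof -
  have "C_on 2 UNIV (\<lambda>v. f v + g v)"
    using assms by (intro C_on_add) (simp_all add: has_quad_jet_def)
  moreover note f = has_quad_jet_differentiable[OF assms(1)] and g = has_quad_jet_differentiable[OF assms(2)]
  have "partial_x (\<lambda>v. f v + g v) = (\<lambda>v. partial_x f v + partial_x g v)"
    "partial_y (\<lambda>v. f v + g v) = (\<lambda>v. partial_y f v + partial_y g v)"
    by (rule partial_add[OF f(1) g(1)])+
  ultimately show ?thesis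
    using assms by (simp add: has_quad_jet_def partial_add[OF f(2) g(2)] partial_add[OF f(3) g(3)])
qed

text \<open>Both factors vanish at the origin, so in the derivatives of the product only the
  products of two first derivatives remain there.\<close>

lemma has_quad_jet_mult:
  assumes "has_quad_jet f a b c d e" "has_quad_jet g a' b' c' d' e'"
  shows "has_quad_jet (\<lambda>v. f v * g v) 0 0 (a * a') (a * b' + b * a') (b * b')"
proof -
  have "C_on 2 UNIV (\<lambda>v. f v * g v)"
    using assms by (intro C_on_mult) (simp_all add: has_quad_jet_def)
  moreover note f = has_quad_jet_differentiable[OF assms(1)] and g = has_quad_jet_differentiable[OF assms(2)]
  have "partial_x (\<lambda>v. f v * g v) = (\<lambda>v. f v * partial_x g v + partial_x f v * g v)"
    "partial_y (\<lambda>v. f v * g v) = (\<lambda>v. f v * partial_y g v + partial_y f v * g v)"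
    by (rule partial_mult[OF f(1) g(1)])+
  moreover note fgx = differentiable_on_mult[OF f(1) g(2)] differentiable_on_mult[OF f(2) g(1)]
    and fgy = differentiable_on_mult[OF f(1) g(3)] differentiable_on_mult[OF f(3) g(1)]
  note partial_add[OF fgx] partial_add[OF fgy] partial_mult[OF f(1) g(2)] partial_mult[OF f(2) g(1)]
    partial_mult[OF f(1) g(3)] partial_mult[OF f(3) g(1)]
  ultimately show ?thesis
    using assms by (simp add: has_quad_jet_def)
qed

lemma has_quad_jet_cmult:
  assumes "has_quad_jet f a b c d e"
  shows "has_quad_jet (\<lambda>v. k * f v) (k * a) (k * b) (k * c) (k * d) (k * e)"
proof -
  have "C_on 2 UNIV (\<lambda>v. k * f v)"
    using assms by (intro C_on_mult) (simp_all add: has_quad_jet_def C_on_const)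
  moreover note f = has_quad_jet_differentiable[OF assms(1)]
  moreover have k: "(\<lambda>_. k) differentiable_on UNIV" by simp
  note partial_mult[OF k f(1)] partial_mult[OF k f(2)] partial_mult[OF k f(3)]
  ultimately show ?thesis
    using assms by (simp add: has_quad_jet_def)
qed

text \<open>The outer function is a polynomial, so the composite is a combination of
  \<open>f\<close>, \<open>g\<close> and their products, and the rules for sums and products give
  its jet.\<close>

lemma has_quad_jet_eval:
  assumes "has_quad_jet f p1 p2 p3 p4 p5" "has_quad_jet g q1 q2 q3 q4 q5"
  shows "has_quad_jet (\<lambda>v. xy_eval (quad_jet a b c d e) (f v, g v))
    (a * p1 + b * q1) (a * p2 + b * q2)
    (a * p3 + b * q3 + c * p1\<^sup>2 + d * p1 * q1 + e * q1\<^sup>2)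
    (a * p4 + b * q4 + 2 * c * p1 * p2 + d * (p1 * q2 + p2 * q1) + 2 * e * q1 * q2)
    (a * p5 + b * q5 + c * p2\<^sup>2 + d * p2 * q2 + e * q2\<^sup>2)"
proof -
  note mult = has_quad_jet_cmult[OF has_quad_jet_mult]
  note f = has_quad_jet_cmult[OF assms(1), of a] and g = has_quad_jet_cmult[OF assms(2), of b]
    and ff = mult[OF assms(1) assms(1), of c] and fg = mult[OF assms(1) assms(2), of d]
    and gg = mult[OF assms(2) assms(2), of e]
  from has_quad_jet_add[OF has_quad_jet_add[OF has_quad_jet_add[OF has_quad_jet_add[OF f g] ff] fg] gg]
  show ?thesis
    by (simp add: algebra_simps power2_eq_square)
qed

lemma has_quad_jet_xy_eval: "has_quad_jet (xy_eval (quad_jet a b c d e)) a b c d e"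
  using has_quad_jet_eval[OF has_quad_jet_fst has_quad_jet_snd, of a b c d e] by simp

lemma vanishing_ideal_2_eq:
  assumes "(0, 0) \<in> E"
  shows "vanishing_ideal 2 E =
    {quad_jet a b c d e | a b c d e. \<exists>f. has_quad_jet f a b c d e \<and> (\<forall>v\<in>E. f v = 0)}"
proof (intro equalityI subsetI)
  fix p assume "p \<in> vanishing_ideal 2 E"
  then obtain f where f: "p = taylor_jet 2 f" "C_on 2 UNIV f" "\<forall>v\<in>E. f v = 0"
    by (auto simp: vanishing_ideal_def)
  with assms have "f (0, 0) = 0" by blast
  with f(2) obtain a b c d e where "has_quad_jet f a b c d e"
    by (rule has_quad_jet_exists)
  with f show "p \<in> {quad_jet a b c d e | a b c d e.
      \<exists>f. has_quad_jet f a b c d e \<and> (\<forall>v\<in>E. f v = 0)}"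
    by (auto simp: has_quad_jet_taylor)
next
  fix p assume "p \<in> {quad_jet a b c d e | a b c d e.
      \<exists>f. has_quad_jet f a b c d e \<and> (\<forall>v\<in>E. f v = 0)}"
  then obtain a b c d e f where "p = quad_jet a b c d e"
    "has_quad_jet f a b c d e" "\<forall>v\<in>E. f v = 0" by auto
  then have "p = taylor_jet 2 f" "C_on 2 UNIV f" "\<forall>v\<in>E. f v = 0"
    by (auto simp: has_quad_jet_taylor has_quad_jet_def)
  then show "p \<in> vanishing_ideal 2 E" by (auto simp: vanishing_ideal_def)
qed

section \<open>Jets under diffeomorphisms\<close>

text \<open>The action of a map on jets in coordinates: the \<open>p\<close> and \<open>q\<close>
  are the coefficients of the 2-jets of its two components. In particular \<open>p1\<close>,
  \<open>p2\<close>, \<open>q1\<close>, \<open>q2\<close> are the entries of its Jacobian matrix at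
  the origin.\<close>

definition quad_jet_subst ::
  "real \<Rightarrow> real \<Rightarrow> real \<Rightarrow> real \<Rightarrow> real \<Rightarrow> real \<Rightarrow> real \<Rightarrow> real \<Rightarrow> real \<Rightarrow> real \<Rightarrow>
   real \<Rightarrow> real \<Rightarrow> real \<Rightarrow> real \<Rightarrow> real \<Rightarrow> real poly poly" where
  "quad_jet_subst p1 p2 p3 p4 p5 q1 q2 q3 q4 q5 a b c d e = quad_jet
    (a * p1 + b * q1) (a * p2 + b * q2)
    (a * p3 + b * q3 + c * p1\<^sup>2 + d * p1 * q1 + e * q1\<^sup>2)
    (a * p4 + b * q4 + 2 * c * p1 * p2 + d * (p1 * q2 + p2 * q1) + 2 * e * q1 * q2)
    (a * p5 + b * q5 + c * p2\<^sup>2 + d * p2 * q2 + e * q2\<^sup>2)"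

lemma taylor_jet_comp:
  assumes "has_quad_jet (fst \<circ> \<phi>) p1 p2 p3 p4 p5" "has_quad_jet (snd \<circ> \<phi>) q1 q2 q3 q4 q5"
  shows "taylor_jet 2 (xy_eval (quad_jet a b c d e) \<circ> \<phi>) =
    quad_jet_subst p1 p2 p3 p4 p5 q1 q2 q3 q4 q5 a b c d e"
  using has_quad_jet_taylor[OF has_quad_jet_eval[OF assms], of a b c d e]
  by (simp add: quad_jet_subst_def comp_def)

text \<open>By the chain rule the derivative of \<open>g\<close> is a left inverse of the Jacobian
  of \<open>\<phi>\<close>, which is therefore injective.\<close>

lemma left_inverse_jacobian:
  assumes \<phi>: "has_quad_jet (fst \<circ> \<phi>) p1 p2 p3 p4 p5" "has_quad_jet (snd \<circ> \<phi>) q1 q2 q3 q4 q5"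
    and g: "(fst \<circ> g) differentiable (at (0, 0))" "(snd \<circ> g) differentiable (at (0, 0))"
    and inv: "\<And>v. g (\<phi> v) = v"
  shows "p1 * q2 \<noteq> p2 * q1"
proof
  assume eq: "p1 * q2 = p2 * q1"
  have "(fst \<circ> \<phi>) differentiable (at (0, 0))" "(snd \<circ> \<phi>) differentiable (at (0, 0))"
    using \<phi> by (auto simp: has_quad_jet_def C_on_2_iff differentiable_on_def)
  from this[THEN has_derivative_partials]
  have "((fst \<circ> \<phi>) has_derivative (\<lambda>h. p1 * fst h + p2 * snd h)) (at (0, 0))"
    "((snd \<circ> \<phi>) has_derivative (\<lambda>h. q1 * fst h + q2 * snd h)) (at (0, 0))"
    using \<phi> by (auto simp: has_quad_jet_def)
  from has_derivative_Pair[OF this]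
  have D\<phi>: "(\<phi> has_derivative (\<lambda>h. (p1 * fst h + p2 * snd h, q1 * fst h + q2 * snd h))) (at (0, 0))"
    by simp
  have \<phi>0: "\<phi> (0, 0) = (0, 0)"
    using \<phi> by (simp add: has_quad_jet_def prod_eq_iff)
  obtain g1 g2 where "((fst \<circ> g) has_derivative g1) (at (0, 0))" "((snd \<circ> g) has_derivative g2) (at (0, 0))"
    using g by (auto simp: differentiable_def)
  from has_derivative_Pair[OF this] obtain g' where Dg: "(g has_derivative g') (at (\<phi> (0, 0)))"
    unfolding \<phi>0 by (simp add: comp_def)
  have "g \<circ> \<phi> = (\<lambda>v. v)" using inv by auto
  with diff_chain_at[OF D\<phi> Dg]
  have "((\<lambda>v. v) has_derivative
      (g' \<circ> (\<lambda>h. (p1 * fst h + p2 * snd h, q1 * fst h + q2 * snd h)))) (at (0, 0))"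
    by simp
  from has_derivative_unique[OF this has_derivative_ident]
  have *: "g' (p1 * fst h + p2 * snd h, q1 * fst h + q2 * snd h) = h" for h
    by (simp add: fun_eq_iff)
  have g0: "g' (0, 0) = (0, 0)" using *[of "(0, 0)"] by simp
  \<comment> \<open>If the determinant vanishes, \<open>(q2, - q1)\<close> and
    \<open>(p2, - p1)\<close> lie in the kernel of the Jacobian. Injectivity makes both zero, so the
    whole matrix is zero and it kills \<open>(1, 0)\<close> too.\<close>
  have "p1 * q2 + p2 * - q1 = 0" "q1 * q2 + q2 * - q1 = 0"
    "p1 * p2 + p2 * - p1 = 0" "q1 * p2 + q2 * - p1 = 0"
    using eq by (simp_all add: mult.commute)
  with *[of "(q2, - q1)"] *[of "(p2, - p1)"] g0 have "p1 = 0" "p2 = 0" "q1 = 0" "q2 = 0"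
    by (simp_all only: fst_conv snd_conv prod.inject neg_0_equal_iff_equal neg_equal_0_iff_equal)
  then show False using *[of "(1, 0)"] g0 by simp
qed

text \<open>Reduces an equivalence to ten real numbers with non-zero Jacobian determinant; the
  non-equivalence proofs then become algebra.\<close>

lemma jet_equivalent_2E:
  assumes "jet_equivalent 2 I J"
  obtains p1 p2 p3 p4 p5 q1 q2 q3 q4 q5 where "p1 * q2 \<noteq> p2 * q1"
    and "\<And>a b c d e. quad_jet a b c d e \<in> I \<Longrightarrow>
      quad_jet_subst p1 p2 p3 p4 p5 q1 q2 q3 q4 q5 a b c d e \<in> J"
    and "\<And>r. r \<in> J \<Longrightarrow> I \<subseteq> jets0 2 \<Longrightarrow> \<exists>a b c d e. quad_jet a b c d e \<in> I \<and>
      r = quad_jet_subst p1 p2 p3 p4 p5 q1 q2 q3 q4 q5 a b c d e"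
proof -
  from assms obtain \<phi> where \<phi>: "C_diffeo 2 \<phi>" "\<phi> (0, 0) = (0, 0)"
    and J: "J = (\<lambda>p. taylor_jet 2 (xy_eval p \<circ> \<phi>)) ` I"
    by (auto simp: jet_equivalent_def)
  have C: "C_on 2 UNIV (fst \<circ> \<phi>)" "C_on 2 UNIV (snd \<circ> \<phi>)"
    "C_on 2 UNIV (fst \<circ> inv_into UNIV \<phi>)" "C_on 2 UNIV (snd \<circ> inv_into UNIV \<phi>)"
    using \<phi>(1) by (auto simp: C_diffeo_def C_map_def)
  obtain p1 p2 p3 p4 p5 where P: "has_quad_jet (fst \<circ> \<phi>) p1 p2 p3 p4 p5"
    by (rule has_quad_jet_exists[OF C(1)]) (simp add: \<phi>(2))
  obtain q1 q2 q3 q4 q5 where Q: "has_quad_jet (snd \<circ> \<phi>) q1 q2 q3 q4 q5"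
    by (rule has_quad_jet_exists[OF C(2)]) (simp add: \<phi>(2))
  note T = taylor_jet_comp[OF P Q]
  show ?thesis
  proof (rule that)
    show "p1 * q2 \<noteq> p2 * q1"
    proof (rule left_inverse_jacobian[OF P Q])
      show "inv_into UNIV \<phi> (\<phi> v) = v" for v
        using \<phi>(1) by (simp add: C_diffeo_def bij_is_inj)
    qed (use C in \<open>auto simp: C_on_2_iff differentiable_on_def\<close>)
  next
    fix a b c d e assume "quad_jet a b c d e \<in> I"
    then show "quad_jet_subst p1 p2 p3 p4 p5 q1 q2 q3 q4 q5 a b c d e \<in> J"
      unfolding J T[symmetric] by (rule imageI)
  next
    fix r assume "r \<in> J" "I \<subseteq> jets0 2"
    then obtain p where p: "p \<in> I" "r = taylor_jet 2 (xy_eval p \<circ> \<phi>)" "p \<in> jets0 2"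
      unfolding J by blast
    from p(3) obtain a b c d e where "p = quad_jet a b c d e" by (rule jets0_2_cases)
    with p T show "\<exists>a b c d e. quad_jet a b c d e \<in> I \<and>
        r = quad_jet_subst p1 p2 p3 p4 p5 q1 q2 q3 q4 q5 a b c d e"
      by blast
  qed
qed

lemma jet_equivalent_2I:
  assumes P: "has_quad_jet (fst \<circ> \<phi>) p1 p2 p3 p4 p5" and Q: "has_quad_jet (snd \<circ> \<phi>) q1 q2 q3 q4 q5"
    and \<psi>: "C_map 2 \<psi>" "\<And>v. \<psi> (\<phi> v) = v" "\<And>v. \<phi> (\<psi> v) = v"
    and IJ: "\<And>a b c d e. quad_jet a b c d e \<in> I \<Longrightarrow>
      quad_jet_subst p1 p2 p3 p4 p5 q1 q2 q3 q4 q5 a b c d e \<in> J"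
    and JI: "\<And>r. r \<in> J \<Longrightarrow> \<exists>a b c d e. quad_jet a b c d e \<in> I \<and>
      r = quad_jet_subst p1 p2 p3 p4 p5 q1 q2 q3 q4 q5 a b c d e"
    and I: "I \<subseteq> jets0 2"
  shows "jet_equivalent 2 I J"
proof -
  have "bij \<phi>"
    by (rule bijI') (use \<psi> in metis)+
  moreover have "inv_into UNIV \<phi> = \<psi>"
    using \<psi> by (intro inv_equality) auto
  ultimately have "C_diffeo 2 \<phi>"
    using P Q \<psi>(1) by (simp add: C_diffeo_def C_map_def has_quad_jet_def)
  moreover have "\<phi> (0, 0) = (0, 0)"
    using P Q by (simp add: has_quad_jet_def prod_eq_iff)
  moreover note T = taylor_jet_comp[OF P Q]
  have "J = (\<lambda>p. taylor_jet 2 (xy_eval p \<circ> \<phi>)) ` I"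
  proof (intro equalityI subsetI)
    fix r assume "r \<in> J"
    from JI[OF this] obtain a b c d e where "quad_jet a b c d e \<in> I"
      "r = taylor_jet 2 (xy_eval (quad_jet a b c d e) \<circ> \<phi>)"
      unfolding T by blast
    then show "r \<in> (\<lambda>p. taylor_jet 2 (xy_eval p \<circ> \<phi>)) ` I"
      by blast
  next
    fix r assume "r \<in> (\<lambda>p. taylor_jet 2 (xy_eval p \<circ> \<phi>)) ` I"
    then obtain p where p: "p \<in> I" "r = taylor_jet 2 (xy_eval p \<circ> \<phi>)" by auto
    from p(1) I obtain a b c d e where "p = quad_jet a b c d e" by (meson jets0_2_cases subsetD)
    with p IJ show "r \<in> J" by (simp add: T)
  qed
  ultimately show ?thesis
    by (auto simp: jet_equivalent_def)
qed

section \<open>Classification of the closed ideals\<close>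

lemma partial_zero: "partial i j (\<lambda>_. 0) = (\<lambda>_. 0)"
proof -
  have "(partial_x ^^ i) (\<lambda>_. 0) = (\<lambda>_. 0)"
    by (induction i) simp_all
  moreover have "(partial_y ^^ j) (\<lambda>_. 0) = (\<lambda>_. 0)"
    by (induction j) simp_all
  ultimately show ?thesis by (simp add: partial_def)
qed

text \<open>The witnesses are the empty list of \<open>Qs\<close> and \<open>F = 0\<close>. The
  identity for \<open>p\<close> is demanded at no point, as \<open>dist_to\<close> is infinite, so
  all constants can be 1.\<close>

lemma implied_if_Allow_empty:
  assumes "Allow m I = {}"
  shows "implied m I p"
proof -
  have "\<exists>F S. C_on m (Ann 4 \<rho>) F \<and> (\<forall>l<length []. C_on m (Ann 4 \<rho>) (S l)) \<and>
      (\<forall>v \<in> Ann 4 \<rho>. \<forall>i j. i + j \<le> m \<longrightarrow> \<bar>partial i j F v\<bar> \<le> \<epsilon> * \<rho> ^ (m - (i + j))) \<and>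
      (\<forall>v \<in> Ann 4 \<rho>. \<forall>i j. i + j \<le> m \<longrightarrow> (\<forall>l<length [].
         \<bar>partial i j (S l) v\<bar> \<le> 1 / \<rho> ^ (i + j))) \<and>
      (\<forall>v \<in> Ann 2 \<rho>. dist_to (v /\<^sub>R norm v) (Allow m I) < ereal 1 \<longrightarrow>
         xy_eval p v = F v + (\<Sum>l<length []. S l v * xy_eval ([] ! l) v))"
    if "\<epsilon> > 0" "0 < \<rho> \<and> \<rho> \<le> 1" for \<epsilon> \<rho> :: real
    by (rule exI[of _ "\<lambda>_. 0"])
      (use that assms in \<open>simp add: C_on_const partial_zero dist_to_def\<close>)
  then have "\<exists>\<delta> r. \<delta> > 0 \<and> r > 0 \<and> (\<forall>\<rho>. 0 < \<rho> \<and> \<rho> \<le> r \<longrightarrow>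
      (\<exists>F S. C_on m (Ann 4 \<rho>) F \<and> (\<forall>l<length []. C_on m (Ann 4 \<rho>) (S l)) \<and>
      (\<forall>v \<in> Ann 4 \<rho>. \<forall>i j. i + j \<le> m \<longrightarrow> \<bar>partial i j F v\<bar> \<le> \<epsilon> * \<rho> ^ (m - (i + j))) \<and>
      (\<forall>v \<in> Ann 4 \<rho>. \<forall>i j. i + j \<le> m \<longrightarrow> (\<forall>l<length [].
         \<bar>partial i j (S l) v\<bar> \<le> 1 / \<rho> ^ (i + j))) \<and>
      (\<forall>v \<in> Ann 2 \<rho>. dist_to (v /\<^sub>R norm v) (Allow m I) < ereal \<delta> \<longrightarrow>
         xy_eval p v = F v + (\<Sum>l<length []. S l v * xy_eval ([] ! l) v))))"
    if "\<epsilon> > 0" for \<epsilon> :: real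
    using that by (intro exI[of _ 1] conjI allI impI) auto
  then show ?thesis
    unfolding implied_def by (intro exI[of _ 1] exI[of _ "[]"]) simp
qed

text \<open>The form satisfies \<open>q v = q (v / norm v) * (norm v)^2\<close>, and near
  \<open>\<omega>\<close> its value on the unit circle stays above half of
  \<open>\<bar>q \<omega>\<bar>\<close> in absolute value. By homogeneity the radius of the cone is
  arbitrary; it is set to 1.\<close>

lemma forbidden_if_form_nonzero:
  assumes "quad_jet 0 0 c d e \<in> I" "xy_eval (quad_jet 0 0 c d e) \<omega> \<noteq> 0"
  shows "forbidden 2 I \<omega>"
proof -
  define q where "q = xy_eval (quad_jet 0 0 c d e)"
  have q: "q v = c * (fst v)\<^sup>2 + d * fst v * snd v + e * (snd v)\<^sup>2" for v
    by (cases v) (simp add: q_def)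
  have "isCont q \<omega>"
    unfolding q by (intro continuous_intros)
  moreover have "\<bar>q \<omega>\<bar> / 2 > 0" using assms(2) by (simp add: q_def)
  ultimately obtain \<delta> where \<delta>: "\<delta> > 0" "\<And>u. dist u \<omega> < \<delta> \<Longrightarrow> dist (q u) (q \<omega>) < \<bar>q \<omega>\<bar> / 2"
    unfolding continuous_at_eps_delta by blast
  have "\<bar>q v\<bar> > \<bar>q \<omega>\<bar> / 2 * (norm v)\<^sup>2" if v: "v \<in> dir_cone \<omega> \<delta> 1" for v
  proof -
    have nv: "norm v > 0" "norm (v /\<^sub>R norm v - \<omega>) < \<delta>"
      using v by (auto simp: dir_cone_def)
    then have "\<bar>q (v /\<^sub>R norm v) - q \<omega>\<bar> < \<bar>q \<omega>\<bar> / 2"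
      using \<delta>(2)[of "v /\<^sub>R norm v"] by (simp only: dist_norm real_norm_def)
    then have "\<bar>q (v /\<^sub>R norm v)\<bar> > \<bar>q \<omega>\<bar> / 2"
      by arith
    moreover have "q v = q (v /\<^sub>R norm v) * (norm v)\<^sup>2"
      using nv(1) unfolding q by (simp add: field_simps power2_eq_square)
    ultimately show ?thesis
      using nv(1) by (simp add: abs_mult)
  qed
  then show ?thesis
    unfolding forbidden_def using assms(1) \<delta>(1) \<open>\<bar>q \<omega>\<bar> / 2 > 0\<close>
    by (intro exI[of _ "[quad_jet 0 0 c d e]"] exI[of _ "\<bar>q \<omega>\<bar> / 2"] exI[of _ \<delta>] exI[of _ 1])
      (simp add: q_def)
qed

text \<open>The one place where closedness enters the classification: without an allowed direction
  every jet in \<open>jets0 2\<close> would be implied and hence lie in \<open>I\<close>. Here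
  \<open>(s, t)\<close> is an allowed direction.\<close>

lemma closed_ideal_common_zero:
  assumes "implication_closed 2 I" "\<not> jets0 2 \<subseteq> I"
  obtains s t where "s\<^sup>2 + t\<^sup>2 = 1"
    and "\<And>c d e. quad_jet 0 0 c d e \<in> I \<Longrightarrow> c * s\<^sup>2 + d * s * t + e * t\<^sup>2 = 0"
proof -
  have "Allow 2 I \<noteq> {}"
    using assms implied_if_Allow_empty by (auto simp: implication_closed_def)
  then obtain s t where st: "(s, t) \<in> sphere 0 1" "\<not> forbidden 2 I (s, t)"
    by (auto simp: Allow_def)
  show ?thesis
  proof (rule that)
    show "s\<^sup>2 + t\<^sup>2 = 1"
      using st(1) by (simp add: norm_Pair)
    show "c * s\<^sup>2 + d * s * t + e * t\<^sup>2 = 0" if "quad_jet 0 0 c d e \<in> I" for c d e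
      using forbidden_if_form_nonzero[OF that, of "(s, t)"] st(2) by auto
  qed
qed

text \<open>If \<open>s\<^sup>2 + t\<^sup>2 = 1\<close>, then in the orthonormal coordinates \<open>u = t x - s y\<close>, \<open>v = s x + t y\<close>, in which
  \<open>(s, t)\<close> spans the \<open>v\<close>-axis, the form \<open>c x\<^sup>2 + d x y + e y\<^sup>2\<close> has coefficients \<open>rotA\<close>, \<open>rotB\<close>, \<open>rotQ\<close> at
  \<open>u\<^sup>2\<close>, \<open>u v\<close>, \<open>v\<^sup>2\<close>.\<close>

definition rotA :: "real \<Rightarrow> real \<Rightarrow> real \<Rightarrow> real \<Rightarrow> real \<Rightarrow> real" where
  "rotA s t c d e = c * t\<^sup>2 - d * s * t + e * s\<^sup>2"

definition rotB :: "real \<Rightarrow> real \<Rightarrow> real \<Rightarrow> real \<Rightarrow> real \<Rightarrow> real" where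
  "rotB s t c d e = 2 * c * s * t + d * (t\<^sup>2 - s\<^sup>2) - 2 * e * s * t"

definition rotQ :: "real \<Rightarrow> real \<Rightarrow> real \<Rightarrow> real \<Rightarrow> real \<Rightarrow> real" where
  "rotQ s t c d e = c * s\<^sup>2 + d * s * t + e * t\<^sup>2"

lemma rot_lin:
  "rotA s t (k * c + l * c') (k * d + l * d') (k * e + l * e') = k * rotA s t c d e + l * rotA s t c' d' e'"
  "rotB s t (k * c + l * c') (k * d + l * d') (k * e + l * e') = k * rotB s t c d e + l * rotB s t c' d' e'"
  "rotQ s t (k * c + l * c') (k * d + l * d') (k * e + l * e') = k * rotQ s t c d e + l * rotQ s t c' d' e'"
  by (simp_all add: rotA_def rotB_def rotQ_def algebra_simps)

lemma rot_scale:
  "rotA s t (k * c) (k * d) (k * e) = k * rotA s t c d e"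
  "rotB s t (k * c) (k * d) (k * e) = k * rotB s t c d e"
  "rotQ s t (k * c) (k * d) (k * e) = k * rotQ s t c d e"
  by (simp_all add: rotA_def rotB_def rotQ_def algebra_simps)

text \<open>All the normalising diffeomorphisms are of the form
  \<open>(u, v) \<mapsto> R (u', \<mu> u' + \<nu> v)\<close> with \<open>u' = u - k v\<^sup>2\<close> and the rotation \<open>R (p, q) = (t p + s q, t q - s p)\<close>.\<close>

lemma quad_jet_subst_normal:
  "quad_jet_subst (t + s * \<mu>) (s * \<nu>) 0 0 (- k * (t + s * \<mu>)) (t * \<mu> - s) (t * \<nu>) 0 0 (- k * (t * \<mu> - s)) a b c d e =
   quad_jet ((a * t - b * s) + \<mu> * (a * s + b * t)) (\<nu> * (a * s + b * t))
     (rotA s t c d e + \<mu> * rotB s t c d e + \<mu>\<^sup>2 * rotQ s t c d e)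
     (\<nu> * (rotB s t c d e + 2 * \<mu> * rotQ s t c d e))
     (\<nu>\<^sup>2 * rotQ s t c d e - k * ((a * t - b * s) + \<mu> * (a * s + b * t)))"
  unfolding quad_jet_subst_def quad_jet_eq_iff rotA_def rotB_def rotQ_def
  by (simp add: algebra_simps power2_eq_square)

text \<open>The bending \<open>k\<close> removes the \<open>v^2\<close> term that accompanies a
  linear generator \<open>u\<close>, and the shear \<open>\<mu>\<close> turns a form
  \<open>u (A u + B v)\<close> with \<open>B\<close> non-zero into a multiple of
  \<open>u v\<close>.\<close>

lemma jet_equivalent_normalI:
  assumes st: "s\<^sup>2 + t\<^sup>2 = 1" and \<nu>: "\<nu> \<noteq> 0" and I: "I \<subseteq> jets0 2"
    and IJ: "\<And>a b c d e. quad_jet a b c d e \<in> I \<Longrightarrow>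
      quad_jet ((a * t - b * s) + \<mu> * (a * s + b * t)) (\<nu> * (a * s + b * t))
       (rotA s t c d e + \<mu> * rotB s t c d e + \<mu>\<^sup>2 * rotQ s t c d e)
       (\<nu> * (rotB s t c d e + 2 * \<mu> * rotQ s t c d e))
       (\<nu>\<^sup>2 * rotQ s t c d e - k * ((a * t - b * s) + \<mu> * (a * s + b * t))) \<in> J"
    and JI: "\<And>r. r \<in> J \<Longrightarrow> \<exists>a b c d e. quad_jet a b c d e \<in> I \<and>
      r = quad_jet ((a * t - b * s) + \<mu> * (a * s + b * t)) (\<nu> * (a * s + b * t))
       (rotA s t c d e + \<mu> * rotB s t c d e + \<mu>\<^sup>2 * rotQ s t c d e)
       (\<nu> * (rotB s t c d e + 2 * \<mu> * rotQ s t c d e))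
       (\<nu>\<^sup>2 * rotQ s t c d e - k * ((a * t - b * s) + \<mu> * (a * s + b * t)))"
  shows "jet_equivalent 2 I J"
proof (rule jet_equivalent_2I[OF _ _ _ _ _ _ _ I])
  let ?P = "quad_jet (t + s * \<mu>) (s * \<nu>) 0 0 (- k * (t + s * \<mu>))"
  let ?Q = "quad_jet (t * \<mu> - s) (t * \<nu>) 0 0 (- k * (t * \<mu> - s))"
  \<comment> \<open>The inverse first recovers \<open>v = \<alpha> x + \<beta> y\<close> by solving
    \<open>s x + t y = \<mu> u' + \<nu> v\<close> with \<open>u' = t x - s y\<close>, and then
    \<open>u = u' + k v^2\<close>.\<close>
  define \<alpha> \<beta> where "\<alpha> = (s - \<mu> * t) / \<nu>" and "\<beta> = (t + \<mu> * s) / \<nu>"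
  define \<phi> where "\<phi> = (\<lambda>v. (xy_eval ?P v, xy_eval ?Q v))"
  define \<psi> where "\<psi> = (\<lambda>v. (xy_eval (quad_jet t (- s) (k * \<alpha>\<^sup>2) (2 * k * \<alpha> * \<beta>) (k * \<beta>\<^sup>2)) v,
    xy_eval (quad_jet \<alpha> \<beta> 0 0 0) v))"
  have \<phi>_eq: "\<phi> (u, v) = (t * (u - k * v\<^sup>2) + s * (\<mu> * (u - k * v\<^sup>2) + \<nu> * v),
      t * (\<mu> * (u - k * v\<^sup>2) + \<nu> * v) - s * (u - k * v\<^sup>2))" for u v
    by (simp add: \<phi>_def algebra_simps)
  have \<psi>_eq: "\<psi> (x, y) = (t * x - s * y + k * ((s * x + t * y - \<mu> * (t * x - s * y)) / \<nu>)\<^sup>2,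
      (s * x + t * y - \<mu> * (t * x - s * y)) / \<nu>)" for x y
  proof -
    have "\<alpha> * x + \<beta> * y = (s * x + t * y - \<mu> * (t * x - s * y)) / \<nu>"
      using \<nu> by (simp add: \<alpha>_def \<beta>_def field_simps)
    then show ?thesis
      by (simp add: \<psi>_def flip: \<open>\<alpha> * x + \<beta> * y = _\<close>) (simp add: algebra_simps power2_eq_square)
  qed
  show "has_quad_jet (fst \<circ> \<phi>) (t + s * \<mu>) (s * \<nu>) 0 0 (- k * (t + s * \<mu>))"
    "has_quad_jet (snd \<circ> \<phi>) (t * \<mu> - s) (t * \<nu>) 0 0 (- k * (t * \<mu> - s))"
    by (simp_all only: \<phi>_def comp_def fst_conv snd_conv has_quad_jet_xy_eval)
  have "C_on 2 UNIV (xy_eval (quad_jet a b c d e))" for a b c d e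
    using has_quad_jet_xy_eval[of a b c d e] unfolding has_quad_jet_def by blast
  then show "C_map 2 \<psi>"
    by (simp only: C_map_def \<psi>_def comp_def fst_conv snd_conv)
  show "\<psi> (\<phi> v) = v" for v
  proof (cases v)
    case (Pair u w)
    define z where "z = u - k * w\<^sup>2"
    have "t * (t * z + s * z') - s * (t * z' - s * z) = (s\<^sup>2 + t\<^sup>2) * z"
      "s * (t * z + s * z') + t * (t * z' - s * z) = (s\<^sup>2 + t\<^sup>2) * z'" for z'
      by (simp_all add: algebra_simps power2_eq_square)
    note this[unfolded st mult_1]
    then show ?thesis
      using \<nu> unfolding Pair \<phi>_eq \<psi>_eq z_def[symmetric] by (simp add: z_def)
  qed
  show "\<phi> (\<psi> v) = v" for v
  proof (cases v)
    case (Pair x y)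
    define l l' where "l = t * x - s * y" and "l' = s * x + t * y"
    have "t * l + s * l' = (s\<^sup>2 + t\<^sup>2) * x" "t * l' - s * l = (s\<^sup>2 + t\<^sup>2) * y"
      by (simp_all add: l_def l'_def algebra_simps power2_eq_square)
    note this[unfolded st mult_1]
    then show ?thesis
      using \<nu> unfolding Pair \<psi>_eq \<phi>_eq l_def[symmetric] l'_def[symmetric] by simp
  qed
qed (use IJ JI in \<open>simp_all only: quad_jet_subst_normal\<close>)

section \<open>Ideals with and without linear parts\<close>

lemma jet_ideal_lin:
  assumes "jet_ideal 2 I" "quad_jet a b c d e \<in> I" "quad_jet a' b' c' d' e' \<in> I"
  shows "quad_jet (k * a + l * a') (k * b + l * b') (k * c + l * c') (k * d + l * d') (k * e + l * e') \<in> I"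
proof -
  have "ideal I (jet_ring 2)" using assms(1) by (simp add: jet_ideal_def)
  then show ?thesis
    using jet_ideal_mult[of I a b c d e k 0 0] jet_ideal_mult[of I a' b' c' d' e' l 0 0] assms
      jet_ideal_add by force
qed

lemma jet_ideal_scale:
  assumes "jet_ideal 2 I" "quad_jet a b c d e \<in> I"
  shows "quad_jet (k * a) (k * b) (k * c) (k * d) (k * e) \<in> I"
  using jet_ideal_lin[OF assms assms(2), of k 0] by simp

text \<open>The products with \<open>x\<close> and with \<open>y\<close>, in which only the linear
  part survives truncation.\<close>

lemma jet_ideal_shift:
  assumes "jet_ideal 2 I" "quad_jet a b c d e \<in> I"
  shows "quad_jet 0 0 a b 0 \<in> I" "quad_jet 0 0 0 a b \<in> I"
  using jet_ideal_mult[of I a b c d e 0 1 0] jet_ideal_mult[of I a b c d e 0 0 1] assms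
  by (simp_all add: jet_ideal_def)

text \<open>In the rotated coordinates every linear part in \<open>I\<close> is a multiple of
  \<open>u\<close>. So \<open>I\<close> contains some \<open>p0\<close> with linear part
  \<open>u\<close>, hence also \<open>u^2\<close> and \<open>u v\<close>, and is spanned by
  \<open>u + k v^2\<close>, \<open>u^2\<close> and \<open>u v\<close>. Replacing \<open>u\<close> by
  \<open>u - k v^2\<close> turns this into the span of \<open>u\<close>, \<open>u^2\<close>,
  \<open>u v\<close>.\<close>

lemma jet_equivalent_x:
  assumes I: "jet_ideal 2 I" and st: "s\<^sup>2 + t\<^sup>2 = 1"
    and van: "\<And>c d e. quad_jet 0 0 c d e \<in> I \<Longrightarrow> rotQ s t c d e = 0"
    and p: "quad_jet a b c d e \<in> I" "a \<noteq> 0 \<or> b \<noteq> 0"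
  shows "jet_equivalent 2 I (jet_span 2 {var_x})"
proof -
  have perp: "a * s + b * t = 0" if "quad_jet a b c d e \<in> I" for a b c d e
  proof -
    \<comment> \<open>The products of the jet with \<open>x\<close> and with \<open>y\<close> are
      forms in \<open>I\<close>; these are their values at \<open>(s, t)\<close>.\<close>
    have "s * (a * s + b * t) = 0" "t * (a * s + b * t) = 0"
      using van[OF jet_ideal_shift(1)[OF I that]] van[OF jet_ideal_shift(2)[OF I that]]
      by (simp_all add: rotQ_def algebra_simps power2_eq_square)
    with st show ?thesis by auto
  qed
  \<comment> \<open>A linear part without \<open>v\<close> component is \<open>a * t - b * s\<close>
    times \<open>u = t x - s y\<close>.\<close>
  have lin: "(a * t - b * s) * t = a" "(a * t - b * s) * s = - b" if "a * s + b * t = 0" for a b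
  proof -
    have "(a * t - b * s) * t = a * (s\<^sup>2 + t\<^sup>2) - s * (a * s + b * t)"
      "(a * t - b * s) * s = t * (a * s + b * t) - b * (s\<^sup>2 + t\<^sup>2)"
      by (simp_all add: algebra_simps power2_eq_square)
    with that st show "(a * t - b * s) * t = a" "(a * t - b * s) * s = - b" by simp_all
  qed
  define L where "L = a * t - b * s"
  have ab: "a = L * t" "b = - L * s"
    using lin[OF perp[OF p(1)], folded L_def] by simp_all
  with p(2) have L: "L \<noteq> 0" by auto
  define c0 d0 e0 where "c0 = c / L" and "d0 = d / L" and "e0 = e / L"
  have p0: "quad_jet t (- s) c0 d0 e0 \<in> I"
    using jet_ideal_scale[OF I p(1), of "1 / L"] L by (simp add: ab c0_def d0_def e0_def)
  define k where "k = rotQ s t c0 d0 e0"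
  \<comment> \<open>This form is \<open>u^2\<close>, and the next one is \<open>u v\<close>; both
    are combinations of \<open>x p0\<close> and \<open>y p0\<close>.\<close>
  have "quad_jet 0 0 (t * t) (- 2 * s * t) (s * s) \<in> I"
    using jet_ideal_lin[OF I jet_ideal_shift[OF I p0], of t "- s"] by (simp add: algebra_simps)
  moreover have "quad_jet 0 0 (s * t) (t * t - s * s) (- s * t) \<in> I"
    using jet_ideal_lin[OF I jet_ideal_shift[OF I p0], of s t] by (simp add: algebra_simps)
  ultimately have forms: "quad_jet 0 0 (C * (t * t) + D * (s * t)) (C * (- 2 * s * t) + D * (t * t - s * s))
      (C * (s * s) + D * (- s * t)) \<in> I" for C D
    using jet_ideal_lin[OF I, of 0 0 "t * t" "- 2 * s * t" "s * s" 0 0 "s * t" "t * t - s * s" "- s * t" C D]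
    by simp
  show ?thesis
  proof (rule jet_equivalent_normalI[OF st, of 1 _ 0 k])
    fix a b c d e assume *: "quad_jet a b c d e \<in> I"
    \<comment> \<open>Subtracting \<open>m p0\<close> cancels the linear part, so the remaining form
      vanishes at \<open>(s, t)\<close>. Thus the \<open>v^2\<close> coefficient of the given jet is
      \<open>m k\<close>, which is what the bending removes.\<close>
    have M: "a * s + b * t = 0" by (rule perp[OF *])
    define m where "m = a * t - b * s"
    have "quad_jet 0 0 (1 * c + - m * c0) (1 * d + - m * d0) (1 * e + - m * e0) \<in> I"
      using jet_ideal_lin[OF I * p0, of 1 "- m"] lin[OF M, folded m_def] by simp
    from van[OF this] have "rotQ s t c d e = k * (a * t - b * s)"
      unfolding rot_lin k_def m_def by (simp add: algebra_simps)
    with M show "quad_jet ((a * t - b * s) + 0 * (a * s + b * t)) (1 * (a * s + b * t))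
       (rotA s t c d e + 0 * rotB s t c d e + 0\<^sup>2 * rotQ s t c d e)
       (1 * (rotB s t c d e + 2 * 0 * rotQ s t c d e))
       (1\<^sup>2 * rotQ s t c d e - k * ((a * t - b * s) + 0 * (a * s + b * t))) \<in> jet_span 2 {var_x}"
      unfolding jet_span_x by simp
  next
    fix r assume "r \<in> jet_span 2 {var_x}"
    then obtain A C D where r: "r = quad_jet A 0 C D 0"
      unfolding jet_span_x by auto
    \<comment> \<open>The preimage of \<open>A x + C x^2 + D x y\<close> is
      \<open>A p0 + C' u^2 + D' u v\<close>; the \<open>u^2\<close> and \<open>u v\<close> terms
      already contributed by \<open>A p0\<close> are subtracted from \<open>C\<close> and
      \<open>D\<close>.\<close>
    define C' D' where "C' = C - A * rotA s t c0 d0 e0" and "D' = D - A * rotB s t c0 d0 e0"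
    define c1 d1 e1 where "c1 = C' * (t * t) + D' * (s * t)"
      and "d1 = C' * (- 2 * s * t) + D' * (t * t - s * s)" and "e1 = C' * (s * s) + D' * (- s * t)"
    have "quad_jet (A * t + 1 * 0) (A * - s + 1 * 0) (A * c0 + 1 * c1) (A * d0 + 1 * d1) (A * e0 + 1 * e1) \<in> I"
      unfolding c1_def d1_def e1_def by (rule jet_ideal_lin[OF I p0 forms])
    moreover have "rotA s t c1 d1 e1 = (s\<^sup>2 + t\<^sup>2)\<^sup>2 * C'" "rotB s t c1 d1 e1 = (s\<^sup>2 + t\<^sup>2)\<^sup>2 * D'"
      "rotQ s t c1 d1 e1 = 0"
      unfolding c1_def d1_def e1_def rotA_def rotB_def rotQ_def
      by (simp_all add: algebra_simps power2_eq_square)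
    then have "rotA s t (A * c0 + 1 * c1) (A * d0 + 1 * d1) (A * e0 + 1 * e1) = C"
      "rotB s t (A * c0 + 1 * c1) (A * d0 + 1 * d1) (A * e0 + 1 * e1) = D"
      "rotQ s t (A * c0 + 1 * c1) (A * d0 + 1 * d1) (A * e0 + 1 * e1) = A * k"
      unfolding rot_lin by (simp_all add: C'_def D'_def k_def st)
    moreover have "A * t * t + A * s * s = (s\<^sup>2 + t\<^sup>2) * A"
      by (simp add: algebra_simps power2_eq_square)
    then have "A * t * t + A * s * s = A"
      by (simp add: st)
    ultimately show "\<exists>a b c d e. quad_jet a b c d e \<in> I \<and>
      r = quad_jet ((a * t - b * s) + 0 * (a * s + b * t)) (1 * (a * s + b * t))
       (rotA s t c d e + 0 * rotB s t c d e + 0\<^sup>2 * rotQ s t c d e)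
       (1 * (rotB s t c d e + 2 * 0 * rotQ s t c d e))
       (1\<^sup>2 * rotQ s t c d e - k * ((a * t - b * s) + 0 * (a * s + b * t)))"
      unfolding r by - (intro exI conjI, assumption, simp)
  qed (use I in \<open>simp_all add: jet_ideal_def\<close>)
qed

text \<open>Every element of \<open>I\<close> is \<open>u (A u + B v)\<close> with \<open>A\<close>,
  \<open>B\<close> given by \<open>rotA\<close>, \<open>rotB\<close>. The pairs
  \<open>(A, B)\<close> form a subspace of the plane; up to shears it is the plane, the line
  \<open>A = 0\<close>, the line \<open>B = 0\<close>, or zero.\<close>

lemma jet_equivalent_forms:
  assumes I: "jet_ideal 2 I" and st: "s\<^sup>2 + t\<^sup>2 = 1"
    and forms: "\<And>a b c d e. quad_jet a b c d e \<in> I \<Longrightarrow> a = 0 \<and> b = 0 \<and> rotQ s t c d e = 0"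
  shows "\<exists>J\<in>{{0}, jet_span 2 {var_x ^ 2}, jet_span 2 {var_x * var_y},
    jet_span 2 {var_x ^ 2, var_x * var_y}}. jet_equivalent 2 I J"
proof -
  have equiv: "jet_equivalent 2 I J"
    if "\<And>c d e. quad_jet 0 0 c d e \<in> I \<Longrightarrow>
        quad_jet 0 0 (rotA s t c d e + \<mu> * rotB s t c d e) (rotB s t c d e) 0 \<in> J"
      and JI: "\<And>r. r \<in> J \<Longrightarrow> \<exists>c d e. quad_jet 0 0 c d e \<in> I \<and>
        r = quad_jet 0 0 (rotA s t c d e + \<mu> * rotB s t c d e) (rotB s t c d e) 0"
    for J \<mu>
  proof (rule jet_equivalent_normalI[OF st, of 1 _ \<mu> 0])
    fix r assume "r \<in> J"
    from JI[OF this] obtain c d e where *: "quad_jet 0 0 c d e \<in> I"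
      "r = quad_jet 0 0 (rotA s t c d e + \<mu> * rotB s t c d e) (rotB s t c d e) 0" by blast
    show "\<exists>a b c d e. quad_jet a b c d e \<in> I \<and>
      r = quad_jet ((a * t - b * s) + \<mu> * (a * s + b * t)) (1 * (a * s + b * t))
       (rotA s t c d e + \<mu> * rotB s t c d e + \<mu>\<^sup>2 * rotQ s t c d e)
       (1 * (rotB s t c d e + 2 * \<mu> * rotQ s t c d e))
       (1\<^sup>2 * rotQ s t c d e - 0 * ((a * t - b * s) + \<mu> * (a * s + b * t)))"
      by (intro exI conjI, rule *(1)) (use forms[OF *(1)] *(2) in simp)
  qed (use I forms that(1) in \<open>force simp: jet_ideal_def\<close>)+
  \<comment> \<open>Two independent pairs \<open>(A, B)\<close>; a line containing a pair with
    \<open>B\<close> non-zero; a line on which \<open>B\<close> vanishes; the zero space.\<close>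
  consider (two) c d e c' d' e' where "quad_jet 0 0 c d e \<in> I" "quad_jet 0 0 c' d' e' \<in> I"
      "rotA s t c d e * rotB s t c' d' e' \<noteq> rotA s t c' d' e' * rotB s t c d e"
    | (mixed) c d e where "quad_jet 0 0 c d e \<in> I" "rotB s t c d e \<noteq> 0"
      "\<And>c' d' e'. quad_jet 0 0 c' d' e' \<in> I \<Longrightarrow>
         rotA s t c d e * rotB s t c' d' e' = rotA s t c' d' e' * rotB s t c d e"
    | (square) c d e where "quad_jet 0 0 c d e \<in> I" "rotA s t c d e \<noteq> 0"
      "\<And>c' d' e'. quad_jet 0 0 c' d' e' \<in> I \<Longrightarrow> rotB s t c' d' e' = 0"
    | (zero) "\<And>c' d' e'. quad_jet 0 0 c' d' e' \<in> I \<Longrightarrow> rotA s t c' d' e' = 0 \<and> rotB s t c' d' e' = 0"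
    by metis
  then show ?thesis
  proof cases
    case two
    define \<Delta> where "\<Delta> = rotA s t c d e * rotB s t c' d' e' - rotA s t c' d' e' * rotB s t c d e"
    have \<Delta>: "\<Delta> \<noteq> 0" using two(3) by (simp add: \<Delta>_def)
    have "jet_equivalent 2 I (jet_span 2 {var_x ^ 2, var_x * var_y})"
    proof (rule equiv[of 0])
      fix r assume "r \<in> jet_span 2 {var_x ^ 2, var_x * var_y}"
      then obtain C D where r: "r = quad_jet 0 0 C D 0" unfolding jet_span_x2_xy by auto
      \<comment> \<open>Cramer's rule for the combination of the two given forms with
        \<open>rotA\<close> equal to \<open>C\<close> and \<open>rotB\<close> equal to
        \<open>D\<close>.\<close>
      define k l where "k = (C * rotB s t c' d' e' - D * rotA s t c' d' e') / \<Delta>"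
        and "l = (D * rotA s t c d e - C * rotB s t c d e) / \<Delta>"
      have "k * rotA s t c d e + l * rotA s t c' d' e' = C"
        "k * rotB s t c d e + l * rotB s t c' d' e' = D"
        using \<Delta> by (simp_all add: k_def l_def field_simps) (simp_all add: \<Delta>_def algebra_simps)
      moreover have "quad_jet 0 0 (k * c + l * c') (k * d + l * d') (k * e + l * e') \<in> I"
        using jet_ideal_lin[OF I two(1,2), of k l] by simp
      ultimately show "\<exists>c d e. quad_jet 0 0 c d e \<in> I \<and>
          r = quad_jet 0 0 (rotA s t c d e + 0 * rotB s t c d e) (rotB s t c d e) 0"
        unfolding r by - (intro exI conjI, assumption, simp add: rot_lin)
    qed (auto simp: jet_span_x2_xy)
    then show ?thesis by blast
  next
    case mixed
    \<comment> \<open>Substituting \<open>\<mu> u + v\<close> for \<open>v\<close> changes the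
      \<open>u^2\<close> coefficient \<open>A\<close> to \<open>A + \<mu> B\<close>. As all pairs
      \<open>(A, B)\<close> are proportional, one \<open>\<mu>\<close> makes it vanish for every
      form in \<open>I\<close>.\<close>
    define \<mu> where "\<mu> = - rotA s t c d e / rotB s t c d e"
    have \<mu>: "rotA s t c' d' e' + \<mu> * rotB s t c' d' e' = 0" if "quad_jet 0 0 c' d' e' \<in> I" for c' d' e'
      using mixed(3)[OF that] mixed(2) by (simp add: \<mu>_def field_simps)
    have "jet_equivalent 2 I (jet_span 2 {var_x * var_y})"
    proof (rule equiv[of \<mu>])
      fix r assume "r \<in> jet_span 2 {var_x * var_y}"
      then obtain D where r: "r = quad_jet 0 0 0 D 0" unfolding jet_span_xy by auto
      define k where "k = D / rotB s t c d e"
      have *: "quad_jet 0 0 (k * c) (k * d) (k * e) \<in> I"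
        using jet_ideal_scale[OF I mixed(1), of k] by simp
      have "rotB s t (k * c) (k * d) (k * e) = D"
        using mixed(2) unfolding rot_scale by (simp add: k_def)
      with * \<mu>[OF *] show "\<exists>c d e. quad_jet 0 0 c d e \<in> I \<and>
          r = quad_jet 0 0 (rotA s t c d e + \<mu> * rotB s t c d e) (rotB s t c d e) 0"
        unfolding r by - (intro exI conjI, assumption, simp)
    qed (auto simp: jet_span_xy \<mu>)
    then show ?thesis by blast
  next
    case square
    have "jet_equivalent 2 I (jet_span 2 {var_x ^ 2})"
    proof (rule equiv[of 0])
      fix r assume "r \<in> jet_span 2 {var_x ^ 2}"
      then obtain C where r: "r = quad_jet 0 0 C 0 0" unfolding jet_span_x2 by auto
      define k where "k = C / rotA s t c d e"
      have *: "quad_jet 0 0 (k * c) (k * d) (k * e) \<in> I"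
        using jet_ideal_scale[OF I square(1), of k] by simp
      have "rotA s t (k * c) (k * d) (k * e) = C"
        using square(2) unfolding rot_scale by (simp add: k_def)
      with * square(3)[OF *] show "\<exists>c d e. quad_jet 0 0 c d e \<in> I \<and>
          r = quad_jet 0 0 (rotA s t c d e + 0 * rotB s t c d e) (rotB s t c d e) 0"
        unfolding r by - (intro exI conjI, assumption, simp)
    qed (auto simp: jet_span_x2 square(3))
    then show ?thesis by blast
  next
    case zero
    have "jet_equivalent 2 I {0}"
    proof (rule equiv[of 0])
      fix r :: "real poly poly" assume "r \<in> {0}"
      then have "r = quad_jet 0 0 0 0 0" by (simp add: quad_jet_0)
      with jet_ideal_zero[OF I] zero[OF jet_ideal_zero[OF I]]
      show "\<exists>c d e. quad_jet 0 0 c d e \<in> I \<and>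
          r = quad_jet 0 0 (rotA s t c d e + 0 * rotB s t c d e) (rotB s t c d e) 0"
        by - (intro exI conjI, assumption, simp)
    qed (auto simp: quad_jet_0 zero)
    then show ?thesis by blast
  qed
qed

lemma jet_equivalent_refl:
  assumes "I \<subseteq> jets0 2"
  shows "jet_equivalent 2 I I"
  by (rule jet_equivalent_2I[of "\<lambda>v. v" 1 0 0 0 0 0 1 0 0 0 "\<lambda>v. v"])
    (use assms has_quad_jet_fst has_quad_jet_snd in
      \<open>auto simp: comp_def C_map_def C_on_fst C_on_snd quad_jet_subst_def elim!: jets0_2_cases\<close>)

lemma closed_ideal_equivalent:
  assumes I: "jet_ideal 2 I" and cl: "implication_closed 2 I"
  shows "\<exists>J\<in>{{0}, jet_span 2 {var_x}, jet_span 2 {var_x ^ 2}, jet_span 2 {var_x * var_y},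
    jet_span 2 {var_x ^ 2, var_x * var_y}, jets0 2}. jet_equivalent 2 I J"
proof (cases "jets0 2 \<subseteq> I")
  case True
  then have "I = jets0 2" using I by (auto simp: jet_ideal_def)
  with jet_equivalent_refl[of I] show ?thesis by auto
next
  case False
  from cl False obtain s t where st: "s\<^sup>2 + t\<^sup>2 = 1"
    and van: "\<And>c d e. quad_jet 0 0 c d e \<in> I \<Longrightarrow> c * s\<^sup>2 + d * s * t + e * t\<^sup>2 = 0"
    by (rule closed_ideal_common_zero) blast
  have van': "rotQ s t c d e = 0" if "quad_jet 0 0 c d e \<in> I" for c d e
    using van[OF that] by (simp add: rotQ_def)
  show ?thesis
  proof (cases "\<exists>a b c d e. quad_jet a b c d e \<in> I \<and> (a \<noteq> 0 \<or> b \<noteq> 0)")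
    case True
    then obtain a b c d e where "quad_jet a b c d e \<in> I" "a \<noteq> 0 \<or> b \<noteq> 0" by blast
    from jet_equivalent_x[OF I st van' this] show ?thesis by blast
  next
    case False
    then have "a = 0 \<and> b = 0 \<and> rotQ s t c d e = 0" if "quad_jet a b c d e \<in> I" for a b c d e
      using that van' by blast
    from jet_equivalent_forms[OF I st this] show ?thesis by blast
  qed
qed

section \<open>The normal forms as vanishing ideals\<close>

lemma has_derivative_along_curve:
  assumes "f differentiable_on UNIV"
    and "(x has_real_derivative x') (at t)" "(y has_real_derivative y') (at t)"
  shows "((\<lambda>t. f (x t, y t)) has_real_derivative
    partial_x f (x t, y t) * x' + partial_y f (x t, y t) * y') (at t)"
proof -
  have xy: "((\<lambda>t. (x t, y t)) has_derivative (\<lambda>h. (x' * h, y' * h))) (at t)"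
    using assms(2,3) by (intro has_derivative_Pair) (simp_all add: has_field_derivative_def)
  have "(f has_derivative (\<lambda>h. partial_x f (x t, y t) * fst h + partial_y f (x t, y t) * snd h))
      (at (x t, y t))"
    using assms(1) by (intro has_derivative_partials) (simp add: differentiable_on_def)
  from diff_chain_at[OF xy this] have "((\<lambda>t. f (x t, y t)) has_derivative
      (\<lambda>h. partial_x f (x t, y t) * (x' * h) + partial_y f (x t, y t) * (y' * h))) (at t)"
    by (simp add: comp_def)
  then show ?thesis
    by (rule has_derivative_imp_has_field_derivative) (simp add: algebra_simps)
qed

lemma has_real_derivative_zero_fun:
  fixes h :: "real \<Rightarrow> real"
  assumes "(h has_real_derivative D) (at t)" "\<And>t. h t = 0"
  shows "D = 0"
proof -
  have "h = (\<lambda>_. 0)" using assms(2) by auto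
  with assms(1) have "((\<lambda>_. 0) has_real_derivative D) (at t)" by simp
  from DERIV_unique[OF this DERIV_const] show ?thesis .
qed

lemma partial_y_zero_on_axis:
  assumes "f differentiable_on UNIV" "\<And>y. f (0, y) = 0"
  shows "partial_y f (0, y) = 0"
  using has_real_derivative_zero_fun[OF
      has_derivative_along_curve[OF assms(1) DERIV_const[of 0] DERIV_ident, of y] assms(2)] by simp

lemma partial_x_zero_on_axis:
  assumes "f differentiable_on UNIV" "\<And>x. f (x, 0) = 0"
  shows "partial_x f (x, 0) = 0"
  using has_real_derivative_zero_fun[OF
      has_derivative_along_curve[OF assms(1) DERIV_ident DERIV_const[of 0], of x] assms(2)] by simp

text \<open>The derivative of \<open>f\<close> along the axis vanishes on the whole axis, so it can
  be differentiated along the axis once more.\<close>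

lemma has_quad_jet_zero_on_y_axis:
  assumes "has_quad_jet f a b c d e" "\<And>y. f (0, y) = 0"
  shows "b = 0" "e = 0"
proof -
  note D = has_quad_jet_differentiable[OF assms(1)]
  have *: "partial_y f (0, y) = 0" for y
    by (rule partial_y_zero_on_axis[OF D(1) assms(2)])
  from *[of 0] partial_y_zero_on_axis[OF D(3) *, of 0] assms(1)
  show "b = 0" "e = 0" by (simp_all add: has_quad_jet_def)
qed

lemma has_quad_jet_zero_on_x_axis:
  assumes "has_quad_jet f a b c d e" "\<And>x. f (x, 0) = 0"
  shows "a = 0" "c = 0"
proof -
  note D = has_quad_jet_differentiable[OF assms(1)]
  have *: "partial_x f (x, 0) = 0" for x
    by (rule partial_x_zero_on_axis[OF D(1) assms(2)])
  from *[of 0] partial_x_zero_on_axis[OF D(2) *, of 0] assms(1)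
  show "a = 0" "c = 0" by (simp_all add: has_quad_jet_def)
qed

text \<open>Meant for intermediate points of the mean value theorem: nothing is known about how they
  depend on \<open>t\<close>, but the bound alone makes them differentiable at 0.\<close>

lemma has_real_derivative_zero_if_quadratic:
  fixes g :: "real \<Rightarrow> real"
  assumes "\<And>t. \<bar>g t\<bar> \<le> t\<^sup>2"
  shows "(g has_real_derivative 0) (at 0)"
proof -
  have g0: "g 0 = 0" using assms[of 0] by simp
  have "((\<lambda>h. g h / h) \<longlongrightarrow> 0) (at 0)"
  proof (rule Lim_null_comparison)
    show "\<forall>\<^sub>F h in at 0. norm (g h / h) \<le> \<bar>h\<bar>"
      unfolding eventually_at_filter
    proof (intro always_eventually allI impI)
      fix h :: real assume "h \<noteq> 0"
      then show "norm (g h / h) \<le> \<bar>h\<bar>"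
        using assms[of h] by (simp add: divide_le_eq power2_eq_square flip: abs_mult)
    qed
    show "((\<lambda>h::real. \<bar>h\<bar>) \<longlongrightarrow> 0) (at 0)"
      using tendsto_rabs[OF tendsto_ident_at[of 0 UNIV]] by simp
  qed
  then show ?thesis by (simp add: DERIV_def g0)
qed

text \<open>The weak bound admits \<open>t = 0\<close> with intermediate point 0, so that a choice
  of intermediate points is a total function satisfying
  \<open>has_real_derivative_zero_if_quadratic\<close>.\<close>

lemma mvt_horizontal:
  assumes "f differentiable_on UNIV"
  shows "\<exists>\<xi>. \<bar>\<xi>\<bar> \<le> t\<^sup>2 \<and> f (t\<^sup>2, t) - f (0, t) = t\<^sup>2 * partial_x f (\<xi>, t)"
proof (cases "t = 0")
  case False
  then have "0 < t\<^sup>2" by simp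
  moreover have "((\<lambda>x. f (x, t)) has_real_derivative partial_x f (x, t)) (at x)" for x
    using has_derivative_along_curve[OF assms DERIV_ident DERIV_const[of t], of x] by simp
  ultimately obtain \<xi> where "0 < \<xi>" "\<xi> < t\<^sup>2" "f (t\<^sup>2, t) - f (0, t) = (t\<^sup>2 - 0) * partial_x f (\<xi>, t)"
    using MVT2[of 0 "t\<^sup>2" "\<lambda>x. f (x, t)" "\<lambda>x. partial_x f (x, t)"] by blast
  then show ?thesis by (intro exI[of _ \<xi>]) simp
next
  case True
  then show ?thesis by (intro exI[of _ 0]) simp
qed

text \<open>Differentiating \<open>f (t^2, t) = 0\<close> twice at 0 gives
  \<open>2 a + 2 e = 0\<close>, and \<open>e = 0\<close> by the \<open>y\<close>-axis. For
  \<open>d\<close>, the quotient \<open>f_x (t^2, t) / t\<close> is shown to tend both to 0, because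
  \<open>f_x\<close> vanishes somewhere between the two curves at each height, and to
  \<open>- d / 2\<close>, by comparing \<open>f_y\<close> on the two curves.\<close>

lemma has_quad_jet_zero_on_tangent_curves:
  assumes f: "has_quad_jet f a b c d e" "\<And>y. f (0, y) = 0" "\<And>y. f (y\<^sup>2, y) = 0"
  shows "a = 0" "d = 0"
proof -
  note D = has_quad_jet_differentiable[OF f(1)]
  let ?fx = "partial_x f" and ?fy = "partial_y f"
  have sq: "((\<lambda>t. t\<^sup>2) has_real_derivative 2 * t) (at t)" for t :: real
    by (auto intro!: derivative_eq_intros)
  have "((\<lambda>t. f (t\<^sup>2, t)) has_real_derivative ?fx (t\<^sup>2, t) * (2 * t) + ?fy (t\<^sup>2, t) * 1) (at t)" for t
    by (rule has_derivative_along_curve[OF D(1) sq DERIV_ident])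
  from has_real_derivative_zero_fun[OF this f(3)]
  have fy: "?fx (t\<^sup>2, t) * (2 * t) + ?fy (t\<^sup>2, t) = 0" for t
    by simp
  \<comment> \<open>The mixed derivative in the order opposite to that of \<open>d\<close>; it is
    the derivative of \<open>f_x\<close> at 0 along every curve \<open>(g t, t)\<close> with
    \<open>g\<close> quadratically small.\<close>
  define w where "w = partial_y ?fx (0, 0)"
  have G: "((\<lambda>t. ?fx (t\<^sup>2, t)) has_real_derivative w) (at 0)"
    using has_derivative_along_curve[OF D(2) sq[of 0] DERIV_ident] by (simp add: w_def)
  have "((\<lambda>t. ?fy (t\<^sup>2, t)) has_real_derivative 2 * e) (at 0)"
    using has_derivative_along_curve[OF D(3) sq[of 0] DERIV_ident] f(1) by (simp add: has_quad_jet_def)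
  from DERIV_add[OF DERIV_mult[OF G DERIV_cmult_Id[of 2]] this]
  have "((\<lambda>t. ?fx (t\<^sup>2, t) * (2 * t) + ?fy (t\<^sup>2, t)) has_real_derivative 2 * ?fx (0, 0) + 2 * e) (at 0)"
    by simp
  from has_real_derivative_zero_fun[OF this fy] have "2 * ?fx (0, 0) + 2 * e = 0" .
  moreover have "e = 0" by (rule has_quad_jet_zero_on_y_axis[OF f(1,2)])
  ultimately show a: "a = 0" using f(1) by (simp add: has_quad_jet_def)
  have "\<forall>t. \<exists>\<xi>. \<bar>\<xi>\<bar> \<le> t\<^sup>2 \<and> f (t\<^sup>2, t) - f (0, t) = t\<^sup>2 * ?fx (\<xi>, t)"
    using mvt_horizontal[OF D(1)] by blast
  then obtain \<xi> where \<xi>: "\<And>t. \<bar>\<xi> t\<bar> \<le> t\<^sup>2" "\<And>t. f (t\<^sup>2, t) - f (0, t) = t\<^sup>2 * ?fx (\<xi> t, t)"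
    by metis
  have \<xi>0: "\<xi> 0 = 0" using \<xi>(1)[of 0] by simp
  \<comment> \<open>For \<open>t = 0\<close> the mean value identity is void, and the claim is
    \<open>a = 0\<close>.\<close>
  have fx: "?fx (\<xi> t, t) = 0" for t
    using \<xi>(2)[of t] f(2,3) a f(1) \<xi>0 by (cases "t = 0") (simp_all add: has_quad_jet_def)
  have "((\<lambda>t. ?fx (\<xi> t, t)) has_real_derivative w) (at 0)"
    using has_derivative_along_curve[OF D(2) has_real_derivative_zero_if_quadratic[OF \<xi>(1)] DERIV_ident]
    by (simp add: w_def \<xi>0)
  from has_real_derivative_zero_fun[OF this fx] have w: "w = 0" .
  have "\<forall>t. \<exists>\<eta>. \<bar>\<eta>\<bar> \<le> t\<^sup>2 \<and> ?fy (t\<^sup>2, t) - ?fy (0, t) = t\<^sup>2 * partial_x ?fy (\<eta>, t)"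
    using mvt_horizontal[OF D(3)] by blast
  then obtain \<eta> where \<eta>: "\<And>t. \<bar>\<eta> t\<bar> \<le> t\<^sup>2"
    "\<And>t. ?fy (t\<^sup>2, t) - ?fy (0, t) = t\<^sup>2 * partial_x ?fy (\<eta> t, t)"
    by metis
  have fy0: "?fy (0, t) = 0" for t
    by (rule partial_y_zero_on_axis[OF D(1) f(2)])
  \<comment> \<open>Both \<open>- 2 t f_x (t^2, t)\<close> and \<open>t^2\<close> times the
    \<open>x\<close>-derivative of \<open>f_y\<close> at \<open>(\<eta> t, t)\<close> equal
    \<open>f_y (t^2, t)\<close>.\<close>
  have "?fx (t\<^sup>2, t) / t = - partial_x ?fy (\<eta> t, t) / 2" if "t \<noteq> 0" for t
  proof -
    have "t * (?fx (t\<^sup>2, t) * 2 + t * partial_x ?fy (\<eta> t, t)) = 0"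
      using \<eta>(2)[of t] fy[of t] fy0[of t] by (simp add: algebra_simps power2_eq_square)
    with that have "?fx (t\<^sup>2, t) * 2 + t * partial_x ?fy (\<eta> t, t) = 0" by (simp only: mult_eq_0_iff) simp
    then have "?fx (t\<^sup>2, t) = t * (- partial_x ?fy (\<eta> t, t) / 2)" by simp
    then show ?thesis using that by simp
  qed
  then have "\<forall>\<^sub>F t in at 0. ?fx (t\<^sup>2, t) / t = - partial_x ?fy (\<eta> t, t) / 2"
    unfolding eventually_at_filter by (intro always_eventually) blast
  moreover have "((\<lambda>t. ?fx (t\<^sup>2, t) / t) \<longlongrightarrow> 0) (at 0)"
    using G w a f(1) by (simp add: DERIV_def has_quad_jet_def)
  ultimately have lim1: "((\<lambda>t. - partial_x ?fy (\<eta> t, t) / 2) \<longlongrightarrow> 0) (at 0)"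
    by (rule Lim_transform_eventually[rotated])
  have lim2: "((\<lambda>t. - partial_x ?fy (\<eta> t, t) / 2) \<longlongrightarrow> - d / 2) (at 0)"
  proof -
    have "\<eta> 0 = 0" using \<eta>(1)[of 0] by simp
    moreover have "isCont \<eta> 0"
      using has_real_derivative_zero_if_quadratic[OF \<eta>(1)] by (rule DERIV_isCont)
    moreover have "isCont (partial_x ?fy) (0, 0)"
      using f(1) by (simp add: has_quad_jet_def C_on_2_iff continuous_on_eq_continuous_at)
    ultimately have "isCont (\<lambda>t. partial_x ?fy (\<eta> t, t)) 0"
      by - (rule isCont_o2[where f="\<lambda>t. (\<eta> t, t)" and g="partial_x ?fy"], simp_all)
    then have "((\<lambda>t. partial_x ?fy (\<eta> t, t)) \<longlongrightarrow> d) (at 0)"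
      using f(1) \<open>\<eta> 0 = 0\<close> by (simp add: isCont_def has_quad_jet_def)
    then show ?thesis by (intro tendsto_intros) simp_all
  qed
  from LIM_unique[OF lim1 lim2] show "d = 0" by simp
qed

text \<open>A two-sided limit restricts to the right. This allows differentiation up to the tip of a
  curve that is only followed for positive parameters.\<close>

lemma has_real_derivative_zero_right:
  fixes h :: "real \<Rightarrow> real"
  assumes h: "(h has_real_derivative D) (at t)" and 0: "\<And>s. s > t \<Longrightarrow> h s = 0"
  shows "h t = 0" "D = 0"
proof -
  have ev: "\<forall>\<^sub>F s in at_right t. h s = 0"
    using 0 by (simp add: eventually_at_filter)
  have lim: "(h \<longlongrightarrow> h t) (at_right t)"
    using DERIV_isCont[OF h] unfolding isCont_def by (rule tendsto_mono[rotated]) (simp add: at_within_le_at)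
  have "(h \<longlongrightarrow> 0) (at_right t)"
    by (rule tendsto_eventually) (rule ev)
  from tendsto_unique[OF trivial_limit_at_right_real lim this] show ht: "h t = 0" .
  have lim': "((\<lambda>s. (h s - h t) / (s - t)) \<longlongrightarrow> D) (at_right t)"
    using h unfolding has_field_derivative_iff by (rule tendsto_mono[rotated]) (simp add: at_within_le_at)
  have "((\<lambda>s. (h s - h t) / (s - t)) \<longlongrightarrow> 0) (at_right t)"
    by (rule tendsto_eventually, rule eventually_mono[OF ev]) (simp add: ht)
  from tendsto_unique[OF trivial_limit_at_right_real lim' this] show "D = 0" .
qed

text \<open>The derivative of \<open>f (t^3, t^2) = 0\<close> is divisible by \<open>t\<close>. The
  quotient \<open>3 t f_x + 2 f_y\<close> vanishes for \<open>t > 0\<close>: its value at 0 gives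
  \<open>b = 0\<close>, its derivative at 0 gives \<open>a = 0\<close>, and this derivative divided
  by \<open>t\<close> tends to \<open>8 e\<close>.\<close>

lemma has_quad_jet_zero_on_half_cusp:
  assumes f: "has_quad_jet f a b c d e" "\<And>t. t \<ge> 0 \<Longrightarrow> f (t ^ 3, t\<^sup>2) = 0"
  shows "a = 0" "b = 0" "e = 0"
proof -
  note D = has_quad_jet_differentiable[OF f(1)]
  let ?fx = "partial_x f" and ?fy = "partial_y f"
  define c1 where "c1 = (\<lambda>t::real. (t ^ 3, t\<^sup>2))"
  have cu: "((\<lambda>t. t ^ 3) has_real_derivative 3 * t\<^sup>2) (at t)" for t :: real
    by (auto intro!: derivative_eq_intros simp: power2_eq_square)
  have sq: "((\<lambda>t. t\<^sup>2) has_real_derivative 2 * t) (at t)" for t :: real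
    by (auto intro!: derivative_eq_intros)
  have along: "((\<lambda>t. g (c1 t)) has_real_derivative
      partial_x g (c1 t) * (3 * t\<^sup>2) + partial_y g (c1 t) * (2 * t)) (at t)"
    if "g differentiable_on UNIV" for g t
    unfolding c1_def by (rule has_derivative_along_curve[OF that cu sq])
  have "?fx (c1 t) * (3 * t\<^sup>2) + ?fy (c1 t) * (2 * t) = 0" if "t \<ge> 0" for t
    by (rule has_real_derivative_zero_right(2)[OF along[OF D(1)]]) (use f(2) that in \<open>simp add: c1_def\<close>)
  then have "t * (3 * t * ?fx (c1 t) + 2 * ?fy (c1 t)) = 0" if "t > 0" for t
    using that[THEN less_imp_le] by (simp add: algebra_simps power2_eq_square)
  then have H0: "3 * t * ?fx (c1 t) + 2 * ?fy (c1 t) = 0" if "t > 0" for t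
    using that by simp
  have H: "((\<lambda>t. 3 * t * ?fx (c1 t) + 2 * ?fy (c1 t)) has_real_derivative
      3 * ?fx (c1 t) + (partial_x ?fx (c1 t) * (3 * t\<^sup>2) + partial_y ?fx (c1 t) * (2 * t)) * (3 * t) +
      2 * (partial_x ?fy (c1 t) * (3 * t\<^sup>2) + partial_y ?fy (c1 t) * (2 * t))) (at t)" for t
    by (rule DERIV_add[OF DERIV_mult[OF DERIV_cmult_Id along[OF D(2)]] DERIV_cmult[OF along[OF D(3)]]])
  have K: "3 * ?fx (c1 t) + (partial_x ?fx (c1 t) * (3 * t\<^sup>2) + partial_y ?fx (c1 t) * (2 * t)) * (3 * t) +
      2 * (partial_x ?fy (c1 t) * (3 * t\<^sup>2) + partial_y ?fy (c1 t) * (2 * t)) = 0" if "t \<ge> 0" for t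
    by (rule has_real_derivative_zero_right(2)[OF H]) (use H0 that in simp)
  have c10: "c1 0 = (0, 0)" by (simp add: c1_def)
  show a: "a = 0"
    using K[of 0] f(1) by (simp add: c10 has_quad_jet_def)
  have "3 * 0 * ?fx (c1 0) + 2 * ?fy (c1 0) = 0"
    by (rule has_real_derivative_zero_right(1)[OF H]) (use H0 in simp)
  then show "b = 0"
    using f(1) by (simp add: c10 has_quad_jet_def)
  have lim: "((\<lambda>t. g (c1 t)) \<longlongrightarrow> g (0, 0)) (at 0)" if "continuous_on UNIV g" for g :: "real \<times> real \<Rightarrow> real"
  proof -
    have "isCont g (c1 0)" using that continuous_on_eq_continuous_at[OF open_UNIV] by blast
    moreover have "isCont c1 0" unfolding c1_def by (intro continuous_intros)
    ultimately have "isCont (\<lambda>t. g (c1 t)) 0" by - (rule isCont_o2[where f=c1 and g=g])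
    then show ?thesis by (simp add: isCont_def c10)
  qed
  have C: "continuous_on UNIV (partial_x ?fx)" "continuous_on UNIV (partial_y ?fx)"
    "continuous_on UNIV (partial_x ?fy)" "continuous_on UNIV (partial_y ?fy)"
    using f(1) by (simp_all add: has_quad_jet_def C_on_2_iff)
  \<comment> \<open>The cusp has zero velocity at \<open>t = 0\<close> and \<open>f_x\<close>
    vanishes at the origin.\<close>
  have "((\<lambda>t. ?fx (c1 t) / t) \<longlongrightarrow> 0) (at 0)"
    using along[OF D(2), of 0] a f(1) by (simp add: DERIV_def c10 has_quad_jet_def)
  then have "((\<lambda>t. 3 * (?fx (c1 t) / t) + (partial_x ?fx (c1 t) * (3 * t\<^sup>2) + partial_y ?fx (c1 t) * (2 * t)) * 3 +
      2 * (partial_x ?fy (c1 t) * (3 * t) + partial_y ?fy (c1 t) * 2)) \<longlongrightarrow>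
      3 * 0 + (partial_x ?fx (0, 0) * (3 * 0\<^sup>2) + partial_y ?fx (0, 0) * (2 * 0)) * 3 +
      2 * (partial_x ?fy (0, 0) * (3 * 0) + partial_y ?fy (0, 0) * 2)) (at 0)"
    by (intro tendsto_intros lim[OF C(1)] lim[OF C(2)] lim[OF C(3)] lim[OF C(4)])
  \<comment> \<open>The second \<open>y\<close>-derivative at the origin is \<open>2 e\<close> and
    enters with factor 4.\<close>
  moreover have "3 * 0 + (partial_x ?fx (0, 0) * (3 * 0\<^sup>2) + partial_y ?fx (0, 0) * (2 * 0)) * 3 +
      2 * (partial_x ?fy (0, 0) * (3 * 0) + partial_y ?fy (0, 0) * 2) = 8 * e"
    using f(1) by (simp add: has_quad_jet_def)
  ultimately have "((\<lambda>t. 3 * (?fx (c1 t) / t) + (partial_x ?fx (c1 t) * (3 * t\<^sup>2) + partial_y ?fx (c1 t) * (2 * t)) * 3 +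
      2 * (partial_x ?fy (c1 t) * (3 * t) + partial_y ?fy (c1 t) * 2)) \<longlongrightarrow> 8 * e) (at 0)"
    by (simp only:)
  note lim_right = tendsto_mono[OF at_within_le_at this, of "{0<..}"]
  have "\<forall>\<^sub>F t in at_right 0. 3 * (?fx (c1 t) / t) +
      (partial_x ?fx (c1 t) * (3 * t\<^sup>2) + partial_y ?fx (c1 t) * (2 * t)) * 3 +
      2 * (partial_x ?fy (c1 t) * (3 * t) + partial_y ?fy (c1 t) * 2) = 0"
    unfolding eventually_at_filter
  proof (intro always_eventually allI impI)
    fix t :: real assume "t \<in> {0<..}"
    then have t: "t > 0" by simp
    have "t * (3 * (?fx (c1 t) / t) + (partial_x ?fx (c1 t) * (3 * t\<^sup>2) + partial_y ?fx (c1 t) * (2 * t)) * 3 +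
      2 * (partial_x ?fy (c1 t) * (3 * t) + partial_y ?fy (c1 t) * 2)) = 0"
      using K[of t] t by (simp add: algebra_simps power2_eq_square)
    then show "3 * (?fx (c1 t) / t) + (partial_x ?fx (c1 t) * (3 * t\<^sup>2) + partial_y ?fx (c1 t) * (2 * t)) * 3 +
      2 * (partial_x ?fy (c1 t) * (3 * t) + partial_y ?fy (c1 t) * 2) = 0"
      using t by (simp only: mult_eq_0_iff) simp
  qed
  from tendsto_unique[OF trivial_limit_at_right_real lim_right tendsto_eventually[OF this]]
  show "e = 0" by simp
qed

text \<open>The root itself is not differentiable at 0; there the difference quotient of the product
  is \<open>sqrt \<bar>h\<bar>\<close>, which tends to 0. Elsewhere the sign of \<open>y\<close> is
  locally constant.\<close>

lemma DERIV_times_sqrt_abs: "((\<lambda>y. y * sqrt \<bar>y\<bar>) has_real_derivative 3 / 2 * sqrt \<bar>y\<bar>) (at y)"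
proof -
  consider "y = 0" | "y > 0" | "y < 0" by linarith
  then show ?thesis
  proof cases
    case 1
    have "isCont (\<lambda>y::real. sqrt \<bar>y\<bar>) 0" by (intro continuous_intros)
    then have "((\<lambda>y::real. sqrt \<bar>y\<bar>) \<longlongrightarrow> 0) (at 0)" by (simp add: isCont_def)
    then have "((\<lambda>h::real. h * sqrt \<bar>h\<bar> / h) \<longlongrightarrow> 0) (at 0)"
      by (rule Lim_transform_eventually) (simp add: eventually_at_filter)
    with 1 show ?thesis by (simp add: DERIV_def)
  next
    case 2
    then have "((\<lambda>y. y * sqrt y) has_real_derivative 3 / 2 * sqrt y) (at y)"
      by (auto intro!: derivative_eq_intros simp: field_simps)
    moreover have "\<forall>\<^sub>F z in nhds y. z * sqrt z = z * sqrt \<bar>z\<bar>"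
      using 2 by (intro eventually_mono[OF eventually_nhds_in_open[of "{0<..}"]]) auto
    ultimately show ?thesis
      using 2 DERIV_cong_ev[of y y "\<lambda>z. z * sqrt z" "\<lambda>z. z * sqrt \<bar>z\<bar>" "3 / 2 * sqrt y"] by simp
  next
    case 3
    then have "((\<lambda>y. y * sqrt (- y)) has_real_derivative 3 / 2 * sqrt (- y)) (at y)"
      by (auto intro!: derivative_eq_intros simp: field_simps)
    moreover have "\<forall>\<^sub>F z in nhds y. z * sqrt (- z) = z * sqrt \<bar>z\<bar>"
      using 3 by (intro eventually_mono[OF eventually_nhds_in_open[of "{..<0}"]]) auto
    ultimately show ?thesis
      using 3 DERIV_cong_ev[of y y "\<lambda>z. z * sqrt (- z)" "\<lambda>z. z * sqrt \<bar>z\<bar>" "3 / 2 * sqrt (- y)"] by simp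
  qed
qed

lemma comp_snd_partials:
  assumes "\<And>y. (h has_real_derivative h' y) (at y)"
  shows "(\<lambda>v :: real \<times> real. h (snd v)) differentiable_on UNIV"
    and "partial_x (\<lambda>v. h (snd v)) = (\<lambda>_. 0)" "partial_y (\<lambda>v. h (snd v)) = (\<lambda>v. h' (snd v))"
proof -
  have D: "((\<lambda>v. h (snd v)) has_derivative (\<lambda>k. h' (snd v) * snd k)) (at v)" for v :: "real \<times> real"
    using diff_chain_at[OF has_derivative_snd[OF has_derivative_ident] has_field_derivative_imp_has_derivative[OF assms]]
    by (simp add: comp_def)
  then show "(\<lambda>v :: real \<times> real. h (snd v)) differentiable_on UNIV"
    unfolding differentiable_on_def differentiable_def by (intro ballI exI) (rule D)
  show "partial_x (\<lambda>v. h (snd v)) = (\<lambda>_. 0)" "partial_y (\<lambda>v. h (snd v)) = (\<lambda>v. h' (snd v))"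
    using partial_x_eq[OF D] partial_y_eq[OF D] by (simp_all add: fun_eq_iff)
qed

text \<open>The second \<open>y\<close>-derivative is \<open>15 / 4 * sqrt \<bar>y\<bar>\<close>,
  which is continuous and vanishes at 0.\<close>

lemma has_quad_jet_sqrt: "has_quad_jet (\<lambda>v. (snd v)\<^sup>2 * sqrt \<bar>snd v\<bar>) 0 0 0 0 0"
proof -
  have "((\<lambda>y. y * (y * sqrt \<bar>y\<bar>)) has_real_derivative 1 * (y * sqrt \<bar>y\<bar>) + 3 / 2 * sqrt \<bar>y\<bar> * y) (at y)" for y
    by (rule DERIV_mult[OF DERIV_ident DERIV_times_sqrt_abs])
  then have "((\<lambda>y. y\<^sup>2 * sqrt \<bar>y\<bar>) has_real_derivative 5 / 2 * (y * sqrt \<bar>y\<bar>)) (at y)" for y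
    by (simp add: power2_eq_square algebra_simps)
  note 1 = comp_snd_partials[OF this]
  note 2 = comp_snd_partials[OF DERIV_cmult[OF DERIV_times_sqrt_abs, of "5 / 2"]]
  have "continuous_on UNIV (\<lambda>v::real \<times> real. 5 / 2 * (3 / 2 * sqrt \<bar>snd v\<bar>))"
    by (intro continuous_intros)
  then show ?thesis
    unfolding has_quad_jet_def C_on_2_iff 1(2,3) 2(2,3) using 1(1) 2(1) by simp
qed

section \<open>Semialgebraic sets realising the ideals of the list\<close>

lemma semialgebraic_UNIV: "semialgebraic UNIV"
  using semialgebraic.eq[of 0] by simp

lemma semialgebraic_Int:
  assumes "semialgebraic A" "semialgebraic B"
  shows "semialgebraic (A \<inter> B)"
  using semialgebraic.compl[OF semialgebraic.union[OF assms[THEN semialgebraic.compl]]] by simp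

lemma has_quad_jet_unique:
  "has_quad_jet f a b c d e \<Longrightarrow> has_quad_jet f a' b' c' d' e' \<Longrightarrow>
     a = a' \<and> b = b' \<and> c = c' \<and> d = d' \<and> e = e'"
  by (auto simp: has_quad_jet_def)

lemma vanishing_ideal_2_eqI:
  assumes "(0, 0) \<in> E"
    and "\<And>f a b c d e. has_quad_jet f a b c d e \<Longrightarrow> (\<And>v. v \<in> E \<Longrightarrow> f v = 0) \<Longrightarrow> quad_jet a b c d e \<in> J"
    and "J \<subseteq> jets0 2"
    and "\<And>a b c d e. quad_jet a b c d e \<in> J \<Longrightarrow> \<exists>f. has_quad_jet f a b c d e \<and> (\<forall>v\<in>E. f v = 0)"
  shows "vanishing_ideal 2 E = J"
proof (intro equalityI subsetI)
  fix p assume "p \<in> J"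
  moreover from this obtain a b c d e where "p = quad_jet a b c d e"
    using assms(3) by (meson jets0_2_cases subsetD)
  ultimately show "p \<in> vanishing_ideal 2 E"
    using assms(4) unfolding vanishing_ideal_2_eq[OF assms(1)] by blast
qed (use assms(2) in \<open>auto simp: vanishing_ideal_2_eq[OF assms(1)]\<close>)

lemma mem_normal_forms:
  "quad_jet a b c d e \<in> {0} \<longleftrightarrow> a = 0 \<and> b = 0 \<and> c = 0 \<and> d = 0 \<and> e = 0"
  "quad_jet a b c d e \<in> jet_span 2 {var_x} \<longleftrightarrow> b = 0 \<and> e = 0"
  "quad_jet a b c d e \<in> jet_span 2 {var_x ^ 2} \<longleftrightarrow> a = 0 \<and> b = 0 \<and> d = 0 \<and> e = 0"
  "quad_jet a b c d e \<in> jet_span 2 {var_x * var_y} \<longleftrightarrow> a = 0 \<and> b = 0 \<and> c = 0 \<and> e = 0"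
  "quad_jet a b c d e \<in> jet_span 2 {var_x ^ 2, var_x * var_y} \<longleftrightarrow> a = 0 \<and> b = 0 \<and> e = 0"
  "quad_jet a b c d e \<in> jets0 2"
  by (auto simp: jet_span_x jet_span_x2 jet_span_xy jet_span_x2_xy)

lemma normal_forms_subset:
  "{0} \<subseteq> jets0 2" "jet_span 2 {var_x} \<subseteq> jets0 2" "jet_span 2 {var_x ^ 2} \<subseteq> jets0 2"
  "jet_span 2 {var_x * var_y} \<subseteq> jets0 2" "jet_span 2 {var_x ^ 2, var_x * var_y} \<subseteq> jets0 2"
  by (auto simp: jet_span_x jet_span_x2 jet_span_xy jet_span_x2_xy simp flip: quad_jet_0)

lemma zero_is_vanishing_ideal: "\<exists>E. semialgebraic E \<and> (0, 0) \<in> E \<and> vanishing_ideal 2 E = {0}"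
proof (intro exI conjI)
  show "vanishing_ideal 2 UNIV = {0}"
  proof (rule vanishing_ideal_2_eqI)
    fix f a b c d e assume *: "has_quad_jet f a b c d e" "\<And>v. v \<in> UNIV \<Longrightarrow> f v = 0"
    then have "f = (\<lambda>_. 0)" by auto
    with * has_quad_jet_zero show "quad_jet a b c d e \<in> {0}"
      using has_quad_jet_unique by (metis quad_jet_0 singletonI)
  qed (use has_quad_jet_zero normal_forms_subset(1) in \<open>auto intro!: exI[of _ "\<lambda>_. 0"]\<close>)
qed (auto simp: semialgebraic_UNIV)

lemma x_is_vanishing_ideal:
  "\<exists>E. semialgebraic E \<and> (0, 0) \<in> E \<and> vanishing_ideal 2 E = jet_span 2 {var_x}"
proof (intro exI conjI)
  let ?E = "{v. xy_eval (quad_jet 1 0 0 0 0) v = 0}"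
  show "semialgebraic ?E" by (rule semialgebraic.eq)
  show "vanishing_ideal 2 ?E = jet_span 2 {var_x}"
  proof (rule vanishing_ideal_2_eqI)
    fix f a b c d e assume "has_quad_jet f a b c d e" "\<And>v. v \<in> ?E \<Longrightarrow> f v = 0"
    then show "quad_jet a b c d e \<in> jet_span 2 {var_x}"
      using has_quad_jet_zero_on_y_axis by (simp add: jet_span_x)
  next
    fix a b c d e assume "quad_jet a b c d e \<in> jet_span 2 {var_x}"
    then show "\<exists>f. has_quad_jet f a b c d e \<and> (\<forall>v\<in>?E. f v = 0)"
      by (intro exI[of _ "xy_eval (quad_jet a b c d e)"]) (auto simp: jet_span_x has_quad_jet_xy_eval)
  qed (auto simp: jet_span_x)
qed auto

lemma xy_is_vanishing_ideal:
  "\<exists>E. semialgebraic E \<and> (0, 0) \<in> E \<and> vanishing_ideal 2 E = jet_span 2 {var_x * var_y}"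
proof (intro exI conjI)
  let ?E = "{v. xy_eval (quad_jet 0 0 0 1 0) v = 0}"
  show "semialgebraic ?E" by (rule semialgebraic.eq)
  show "vanishing_ideal 2 ?E = jet_span 2 {var_x * var_y}"
  proof (rule vanishing_ideal_2_eqI)
    fix f a b c d e assume "has_quad_jet f a b c d e" "\<And>v. v \<in> ?E \<Longrightarrow> f v = 0"
    then show "quad_jet a b c d e \<in> jet_span 2 {var_x * var_y}"
      using has_quad_jet_zero_on_y_axis has_quad_jet_zero_on_x_axis by (simp add: jet_span_xy)
  next
    fix a b c d e assume "quad_jet a b c d e \<in> jet_span 2 {var_x * var_y}"
    then show "\<exists>f. has_quad_jet f a b c d e \<and> (\<forall>v\<in>?E. f v = 0)"
      by (intro exI[of _ "xy_eval (quad_jet a b c d e)"]) (auto simp: jet_span_xy has_quad_jet_xy_eval)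
  qed (auto simp: jet_span_xy)
qed auto

lemma x2_is_vanishing_ideal:
  "\<exists>E. semialgebraic E \<and> (0, 0) \<in> E \<and> vanishing_ideal 2 E = jet_span 2 {var_x ^ 2}"
proof (intro exI conjI)
  \<comment> \<open>The polynomial is \<open>x (x - y^2)\<close>.\<close>
  let ?E = "{v. xy_eval (xy_monom 1 2 0 + xy_monom (- 1) 1 2) v = 0}"
  show "semialgebraic ?E" by (rule semialgebraic.eq)
  show "vanishing_ideal 2 ?E = jet_span 2 {var_x ^ 2}"
  proof (rule vanishing_ideal_2_eqI)
    fix f a b c d e assume *: "has_quad_jet f a b c d e" "\<And>v. v \<in> ?E \<Longrightarrow> f v = 0"
    have "f (0, y) = 0" "f (y\<^sup>2, y) = 0" for y
      by (auto intro!: *(2) simp: power2_eq_square)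
    with *(1) show "quad_jet a b c d e \<in> jet_span 2 {var_x ^ 2}"
      using has_quad_jet_zero_on_y_axis has_quad_jet_zero_on_tangent_curves by (simp add: jet_span_x2)
  next
    fix a b c d e assume J: "quad_jet a b c d e \<in> jet_span 2 {var_x ^ 2}"
    \<comment> \<open>The function \<open>c x (x - y^2)\<close>; its cubic term has zero
      2-jet.\<close>
    have "has_quad_jet (\<lambda>v. c * (fst v * fst v) + - c * (fst v * (snd v * snd v))) 0 0 c 0 0"
      using has_quad_jet_add[OF
          has_quad_jet_cmult[OF has_quad_jet_mult[OF has_quad_jet_fst has_quad_jet_fst], of c]
          has_quad_jet_cmult[OF has_quad_jet_mult[OF has_quad_jet_fst
            has_quad_jet_mult[OF has_quad_jet_snd has_quad_jet_snd]], of "- c"]] by simp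
    moreover have "c * (fst v * fst v) + - c * (fst v * (snd v * snd v)) = 0" if "v \<in> ?E" for v
    proof -
      have "c * (fst v * fst v) + - c * (fst v * (snd v * snd v)) =
          c * xy_eval (xy_monom 1 2 0 + xy_monom (- 1) 1 2) v"
        by (cases v) (simp add: algebra_simps power2_eq_square)
      with that show ?thesis by simp
    qed
    ultimately show "\<exists>f. has_quad_jet f a b c d e \<and> (\<forall>v\<in>?E. f v = 0)"
      using J by (auto simp: jet_span_x2)
  qed (auto simp: jet_span_x2)
qed auto

lemma x2_xy_is_vanishing_ideal:
  "\<exists>E. semialgebraic E \<and> (0, 0) \<in> E \<and> vanishing_ideal 2 E = jet_span 2 {var_x ^ 2, var_x * var_y}"
proof (intro exI conjI)
  \<comment> \<open>The condition \<open>x \<ge> 0\<close> is written as the complement of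
    \<open>- x > 0\<close>.\<close>
  let ?E = "{v. xy_eval (xy_monom 1 2 0 + xy_monom (- 1) 0 3) v = 0} \<inter>
    - {v. xy_eval (xy_monom (- 1) 1 0) v > 0}"
  show "semialgebraic ?E"
    by (intro semialgebraic_Int semialgebraic.compl semialgebraic.eq semialgebraic.gt)
  show "vanishing_ideal 2 ?E = jet_span 2 {var_x ^ 2, var_x * var_y}"
  proof (rule vanishing_ideal_2_eqI)
    fix f a b c d e assume *: "has_quad_jet f a b c d e" "\<And>v. v \<in> ?E \<Longrightarrow> f v = 0"
    \<comment> \<open>Only \<open>t \<ge> 0\<close> stays in the half plane
      \<open>x \<ge> 0\<close>.\<close>
    have "f (t ^ 3, t\<^sup>2) = 0" if "t \<ge> 0" for t
      by (rule *(2)) (use that in \<open>simp add: power_mult[symmetric]\<close>)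
    from has_quad_jet_zero_on_half_cusp[OF *(1) this]
    show "quad_jet a b c d e \<in> jet_span 2 {var_x ^ 2, var_x * var_y}"
      by (simp add: jet_span_x2_xy)
  next
    fix a b c d e assume J: "quad_jet a b c d e \<in> jet_span 2 {var_x ^ 2, var_x * var_y}"
    \<comment> \<open>A combination of \<open>x^2 - y^3\<close> and
      \<open>x y - y^2 sqrt \<bar>y\<bar>\<close>, which vanish on the half cusp and have the jets
      \<open>x^2\<close> and \<open>x y\<close>.\<close>
    let ?f = "\<lambda>v. (c * (fst v * fst v) + - c * (snd v * (snd v * snd v))) +
      (d * (fst v * snd v) + - d * ((snd v)\<^sup>2 * sqrt \<bar>snd v\<bar>))"
    have "has_quad_jet ?f 0 0 c d 0"
      using has_quad_jet_add[OF
          has_quad_jet_add[OF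
            has_quad_jet_cmult[OF has_quad_jet_mult[OF has_quad_jet_fst has_quad_jet_fst], of c]
            has_quad_jet_cmult[OF has_quad_jet_mult[OF has_quad_jet_snd
              has_quad_jet_mult[OF has_quad_jet_snd has_quad_jet_snd]], of "- c"]]
          has_quad_jet_add[OF
            has_quad_jet_cmult[OF has_quad_jet_mult[OF has_quad_jet_fst has_quad_jet_snd], of d]
            has_quad_jet_cmult[OF has_quad_jet_sqrt, of "- d"]]] by simp
    moreover have "?f v = 0" if "v \<in> ?E" for v
    proof (cases v)
      case (Pair x y)
      with that have xy: "x\<^sup>2 = y ^ 3" "x \<ge> 0" by auto
      have y: "y \<ge> 0"
      proof (rule ccontr)
        assume "\<not> y \<ge> 0"
        then have "y ^ 3 < 0" by simp
        with xy(1) zero_le_power2[of x] show False by linarith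
      qed
      \<comment> \<open>The sign condition on \<open>x\<close> selects this root; on the other
        branch \<open>x y\<close> would be \<open>- y^2 sqrt y\<close>.\<close>
      have "x = sqrt (y ^ 3)" using xy by (simp add: real_sqrt_unique)
      also have "\<dots> = y * sqrt y"
        using y by (simp add: power3_eq_cube real_sqrt_mult)
      finally have "x * y = y\<^sup>2 * sqrt y" by (simp add: power2_eq_square)
      moreover have "x * x = y * (y * y)"
        using xy(1) by (simp add: power2_eq_square power3_eq_cube)
      ultimately show ?thesis
        using y by (simp add: Pair)
    qed
    moreover have "a = 0" "b = 0" "e = 0"
      using J by (simp_all add: mem_normal_forms)
    ultimately show "\<exists>f. has_quad_jet f a b c d e \<and> (\<forall>v\<in>?E. f v = 0)"
      by blast
  qed (auto simp: jet_span_x2_xy)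
qed auto

lemma jets0_is_vanishing_ideal: "\<exists>E. semialgebraic E \<and> (0, 0) \<in> E \<and> vanishing_ideal 2 E = jets0 2"
proof (intro exI conjI)
  let ?E = "{v. xy_eval (quad_jet 0 0 1 0 1) v = 0}"
  show "semialgebraic ?E" by (rule semialgebraic.eq)
  show "vanishing_ideal 2 ?E = jets0 2"
  proof (rule vanishing_ideal_2_eqI)
    fix a b c d e
    have "?E = {(0, 0)}" by auto
    then show "\<exists>f. has_quad_jet f a b c d e \<and> (\<forall>v\<in>?E. f v = 0)"
      by (intro exI[of _ "xy_eval (quad_jet a b c d e)"]) (simp add: has_quad_jet_xy_eval)
  qed auto
qed auto

section \<open>Non-equivalence of the normal forms\<close>

text \<open>Linear parts are transformed among themselves by the invertible Jacobian, so a zero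
  linear part stays zero and a non-zero one stays non-zero.\<close>

lemma jet_equivalent_linear_part:
  assumes eq: "jet_equivalent 2 I J" and I: "I \<subseteq> jets0 2"
  shows "(\<exists>a b c d e. quad_jet a b c d e \<in> I \<and> (a \<noteq> 0 \<or> b \<noteq> 0)) \<longleftrightarrow>
    (\<exists>a b c d e. quad_jet a b c d e \<in> J \<and> (a \<noteq> 0 \<or> b \<noteq> 0))"
proof -
  from eq obtain p1 p2 p3 p4 p5 q1 q2 q3 q4 q5 where det: "p1 * q2 \<noteq> p2 * q1"
    and IJ: "\<And>a b c d e. quad_jet a b c d e \<in> I \<Longrightarrow>
      quad_jet_subst p1 p2 p3 p4 p5 q1 q2 q3 q4 q5 a b c d e \<in> J"
    and JI: "\<And>r. r \<in> J \<Longrightarrow> I \<subseteq> jets0 2 \<Longrightarrow> \<exists>a b c d e. quad_jet a b c d e \<in> I \<and>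
      r = quad_jet_subst p1 p2 p3 p4 p5 q1 q2 q3 q4 q5 a b c d e"
    by (rule jet_equivalent_2E) blast
  show ?thesis
  proof
    assume "\<exists>a b c d e. quad_jet a b c d e \<in> I \<and> (a \<noteq> 0 \<or> b \<noteq> 0)"
    then obtain a b c d e where *: "quad_jet a b c d e \<in> I" "a \<noteq> 0 \<or> b \<noteq> 0" by blast
    \<comment> \<open>The adjugate of the Jacobian recovers \<open>(a, b)\<close> from the
      transformed linear part.\<close>
    have "a * (p1 * q2 - p2 * q1) = (a * p1 + b * q1) * q2 - (a * p2 + b * q2) * q1"
      "b * (p1 * q2 - p2 * q1) = (a * p2 + b * q2) * p1 - (a * p1 + b * q1) * p2"
      by (simp_all add: algebra_simps)
    with det *(2) have "a * p1 + b * q1 \<noteq> 0 \<or> a * p2 + b * q2 \<noteq> 0" by auto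
    with IJ[OF *(1)] show "\<exists>a b c d e. quad_jet a b c d e \<in> J \<and> (a \<noteq> 0 \<or> b \<noteq> 0)"
      unfolding quad_jet_subst_def by blast
  next
    assume "\<exists>a b c d e. quad_jet a b c d e \<in> J \<and> (a \<noteq> 0 \<or> b \<noteq> 0)"
    then obtain a b c d e where *: "quad_jet a b c d e \<in> J" "a \<noteq> 0 \<or> b \<noteq> 0" by blast
    from JI[OF *(1) I] obtain a' b' c' d' e' where "quad_jet a' b' c' d' e' \<in> I"
      "quad_jet a b c d e = quad_jet_subst p1 p2 p3 p4 p5 q1 q2 q3 q4 q5 a' b' c' d' e'" by blast
    with *(2) show "\<exists>a b c d e. quad_jet a b c d e \<in> I \<and> (a \<noteq> 0 \<or> b \<noteq> 0)"
      unfolding quad_jet_subst_def quad_jet_eq_iff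
      by (intro exI[of _ a'] exI[of _ b'] exI[of _ c'] exI[of _ d'] exI[of _ e']) auto
  qed
qed

lemma not_equivalent_linear_part:
  assumes "I \<in> {{0}, jet_span 2 {var_x ^ 2}, jet_span 2 {var_x * var_y},
    jet_span 2 {var_x ^ 2, var_x * var_y}}" and "J \<in> {jet_span 2 {var_x}, jets0 2}"
  shows "\<not> jet_equivalent 2 I J" "\<not> jet_equivalent 2 J I"
proof -
  have "quad_jet 1 0 0 0 0 \<in> J" "J \<subseteq> jets0 2"
    using assms(2) normal_forms_subset by (auto simp: mem_normal_forms)
  moreover have "quad_jet a b c d e \<notin> I \<or> a = 0 \<and> b = 0" for a b c d e
    using assms(1) by (auto simp: mem_normal_forms)
  moreover have "I \<subseteq> jets0 2"
    using assms(1) normal_forms_subset by auto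
  ultimately show "\<not> jet_equivalent 2 I J" "\<not> jet_equivalent 2 J I"
    using jet_equivalent_linear_part[of I J] jet_equivalent_linear_part[of J I] zero_neq_one
    by metis+
qed

lemma not_equivalent_zero:
  assumes "J \<in> {jet_span 2 {var_x ^ 2}, jet_span 2 {var_x * var_y},
    jet_span 2 {var_x ^ 2, var_x * var_y}}"
  shows "\<not> jet_equivalent 2 {0} J" "\<not> jet_equivalent 2 J {0}"
proof -
  have J: "quad_jet 0 0 1 0 0 \<in> J \<or> quad_jet 0 0 0 1 0 \<in> J"
    using assms by (auto simp: mem_normal_forms)
  show "\<not> jet_equivalent 2 {0} J"
  proof
    assume "jet_equivalent 2 {0} J"
    then obtain p1 p2 p3 p4 p5 q1 q2 q3 q4 q5 where
      JI: "\<And>r. r \<in> J \<Longrightarrow> {0} \<subseteq> jets0 2 \<Longrightarrow> \<exists>a b c d e. quad_jet a b c d e \<in> {0} \<and>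
        r = quad_jet_subst p1 p2 p3 p4 p5 q1 q2 q3 q4 q5 a b c d e"
      by (rule jet_equivalent_2E) blast
    from J JI[OF _ normal_forms_subset(1)] show False
      by (force simp: quad_jet_subst_def)
  qed
  show "\<not> jet_equivalent 2 J {0}"
  proof
    assume "jet_equivalent 2 J {0}"
    then obtain p1 p2 p3 p4 p5 q1 q2 q3 q4 q5 where det: "p1 * q2 \<noteq> p2 * q1"
      and IJ: "\<And>a b c d e. quad_jet a b c d e \<in> J \<Longrightarrow>
        quad_jet_subst p1 p2 p3 p4 p5 q1 q2 q3 q4 q5 a b c d e \<in> {0}"
      by (rule jet_equivalent_2E) blast
    from J show False
    proof
      assume "quad_jet 0 0 1 0 0 \<in> J"
      from IJ[OF this] det show False by (simp add: quad_jet_subst_def)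
    next
      assume "quad_jet 0 0 0 1 0 \<in> J"
      \<comment> \<open>The image of \<open>x y\<close> is the product of the linear forms
        \<open>p1 x + p2 y\<close> and \<open>q1 x + q2 y\<close>. If it is zero, one factor is
        zero, against \<open>det\<close>.\<close>
      from IJ[OF this] have "p1 * q1 = 0" "p1 * q2 + p2 * q1 = 0" "p2 * q2 = 0"
        by (simp_all add: quad_jet_subst_def)
      with det show False by (auto simp: mult_eq_0_iff)
    qed
  qed
qed

text \<open>The linear parts occurring in the two ideals span a line and a plane. The images of
  those of \<open>\<langle>x\<rangle>\<close> are multiples of \<open>(p1, p2)\<close>.\<close>

lemma not_equivalent_x_jets0:
  "\<not> jet_equivalent 2 (jet_span 2 {var_x}) (jets0 2)"
  "\<not> jet_equivalent 2 (jets0 2) (jet_span 2 {var_x})"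
proof
  assume "jet_equivalent 2 (jet_span 2 {var_x}) (jets0 2)"
  then obtain p1 p2 p3 p4 p5 q1 q2 q3 q4 q5 where
    JI: "\<And>r. r \<in> jets0 2 \<Longrightarrow> jet_span 2 {var_x} \<subseteq> jets0 2 \<Longrightarrow>
      \<exists>a b c d e. quad_jet a b c d e \<in> jet_span 2 {var_x} \<and>
        r = quad_jet_subst p1 p2 p3 p4 p5 q1 q2 q3 q4 q5 a b c d e"
    by (rule jet_equivalent_2E) blast
  note * = JI[OF quad_jet_in_jets0 normal_forms_subset(2), unfolded mem_normal_forms quad_jet_subst_def quad_jet_eq_iff]
  obtain a a' where "1 = a * p1" "0 = a * p2" "1 = a' * p2"
    using *[of 1 0 0 0 0] *[of 0 1 0 0 0] by auto
  then show False by auto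
next
  show "\<not> jet_equivalent 2 (jets0 2) (jet_span 2 {var_x})"
  proof
    assume "jet_equivalent 2 (jets0 2) (jet_span 2 {var_x})"
    then obtain p1 p2 p3 p4 p5 q1 q2 q3 q4 q5 where det: "p1 * q2 \<noteq> p2 * q1"
      and IJ: "\<And>a b c d e. quad_jet a b c d e \<in> jets0 2 \<Longrightarrow>
        quad_jet_subst p1 p2 p3 p4 p5 q1 q2 q3 q4 q5 a b c d e \<in> jet_span 2 {var_x}"
      by (rule jet_equivalent_2E) blast
    note * = IJ[OF quad_jet_in_jets0, unfolded mem_normal_forms quad_jet_subst_def]
    from *[of 1 0 0 0 0] *[of 0 1 0 0 0] det show False by simp
  qed
qed

text \<open>Forms in the ideal of \<open>x^2\<close> are multiples of a square of a linear form, and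
  invertible substitutions preserve this; \<open>x y\<close> is not such a multiple.\<close>

lemma not_equivalent_x2:
  assumes "J \<in> {jet_span 2 {var_x * var_y}, jet_span 2 {var_x ^ 2, var_x * var_y}}"
  shows "\<not> jet_equivalent 2 (jet_span 2 {var_x ^ 2}) J"
    and "\<not> jet_equivalent 2 J (jet_span 2 {var_x ^ 2})"
proof -
  have J: "quad_jet 0 0 0 1 0 \<in> J"
    using assms by (auto simp: mem_normal_forms)
  show "\<not> jet_equivalent 2 (jet_span 2 {var_x ^ 2}) J"
  proof
    assume "jet_equivalent 2 (jet_span 2 {var_x ^ 2}) J"
    then obtain p1 p2 p3 p4 p5 q1 q2 q3 q4 q5 where
      JI: "\<And>r. r \<in> J \<Longrightarrow> jet_span 2 {var_x ^ 2} \<subseteq> jets0 2 \<Longrightarrow>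
        \<exists>a b c d e. quad_jet a b c d e \<in> jet_span 2 {var_x ^ 2} \<and>
          r = quad_jet_subst p1 p2 p3 p4 p5 q1 q2 q3 q4 q5 a b c d e"
      by (rule jet_equivalent_2E) blast
    from JI[OF J normal_forms_subset(3), unfolded mem_normal_forms quad_jet_subst_def quad_jet_eq_iff]
    obtain c where "0 = c * p1\<^sup>2" "1 = 2 * c * p1 * p2" by auto
    then show False by auto
  qed
  show "\<not> jet_equivalent 2 J (jet_span 2 {var_x ^ 2})"
  proof
    assume "jet_equivalent 2 J (jet_span 2 {var_x ^ 2})"
    then obtain p1 p2 p3 p4 p5 q1 q2 q3 q4 q5 where det: "p1 * q2 \<noteq> p2 * q1"
      and IJ: "\<And>a b c d e. quad_jet a b c d e \<in> J \<Longrightarrow>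
        quad_jet_subst p1 p2 p3 p4 p5 q1 q2 q3 q4 q5 a b c d e \<in> jet_span 2 {var_x ^ 2}"
      by (rule jet_equivalent_2E) blast
    from IJ[OF J, unfolded mem_normal_forms quad_jet_subst_def]
    have "p1 * q2 + p2 * q1 = 0" "p2 * q2 = 0" by simp_all
    with det show False by (auto simp: mult_eq_0_iff)
  qed
qed

text \<open>An image of the ideal of \<open>x y\<close> consists of the multiples of one form, so it
  cannot contain both \<open>x^2\<close> and \<open>x y\<close>. Conversely, the image of
  \<open>x^2\<close> is the square of a non-zero linear form, which is never a multiple of
  \<open>x y\<close>.\<close>

lemma not_equivalent_xy:
  "\<not> jet_equivalent 2 (jet_span 2 {var_x * var_y}) (jet_span 2 {var_x ^ 2, var_x * var_y})"
  "\<not> jet_equivalent 2 (jet_span 2 {var_x ^ 2, var_x * var_y}) (jet_span 2 {var_x * var_y})"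
proof
  let ?I = "jet_span 2 {var_x * var_y}" and ?J = "jet_span 2 {var_x ^ 2, var_x * var_y}"
  assume "jet_equivalent 2 ?I ?J"
  then obtain p1 p2 p3 p4 p5 q1 q2 q3 q4 q5 where
    JI: "\<And>r. r \<in> ?J \<Longrightarrow> ?I \<subseteq> jets0 2 \<Longrightarrow> \<exists>a b c d e. quad_jet a b c d e \<in> ?I \<and>
        r = quad_jet_subst p1 p2 p3 p4 p5 q1 q2 q3 q4 q5 a b c d e"
    by (rule jet_equivalent_2E) blast
  have "quad_jet 0 0 1 0 0 \<in> ?J" "quad_jet 0 0 0 1 0 \<in> ?J"
    by (simp_all add: mem_normal_forms)
  note * = this[THEN JI, OF normal_forms_subset(4), unfolded mem_normal_forms quad_jet_subst_def quad_jet_eq_iff]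
  from * obtain d d' where "1 = d * p1 * q1" "0 = d' * p1 * q1" "1 = d' * (p1 * q2 + p2 * q1)"
    by auto
  then show False by auto
next
  let ?I = "jet_span 2 {var_x * var_y}" and ?J = "jet_span 2 {var_x ^ 2, var_x * var_y}"
  show "\<not> jet_equivalent 2 ?J ?I"
  proof
    assume "jet_equivalent 2 ?J ?I"
    then obtain p1 p2 p3 p4 p5 q1 q2 q3 q4 q5 where det: "p1 * q2 \<noteq> p2 * q1"
      and IJ: "\<And>a b c d e. quad_jet a b c d e \<in> ?J \<Longrightarrow>
        quad_jet_subst p1 p2 p3 p4 p5 q1 q2 q3 q4 q5 a b c d e \<in> ?I"
      by (rule jet_equivalent_2E) blast
    from IJ[of 0 0 1 0 0] det show False
      by (simp add: mem_normal_forms quad_jet_subst_def)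
  qed
qed

theorem theorem1p3:
  shows "let normal_forms =
           [{0}, jet_span 2 {var_x}, jet_span 2 {var_x ^ 2}, jet_span 2 {var_x * var_y},
            jet_span 2 {var_x ^ 2, var_x * var_y}, jets0 2]
         in (\<forall>I. jet_ideal 2 I \<and> implication_closed 2 I \<longrightarrow>
               (\<exists>J \<in> set normal_forms. jet_equivalent 2 I J)) \<and>
            (\<forall>J \<in> set normal_forms.
               \<exists>E. semialgebraic E \<and> (0, 0) \<in> E \<and> vanishing_ideal 2 E = J) \<and>
            distinct normal_forms \<and>
            (\<forall>J \<in> set normal_forms. \<forall>J' \<in> set normal_forms. J \<noteq> J' \<longrightarrow> \<not> jet_equivalent 2 J J')"
proof -
  let ?forms = "[{0}, jet_span 2 {var_x}, jet_span 2 {var_x ^ 2}, jet_span 2 {var_x * var_y},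
    jet_span 2 {var_x ^ 2, var_x * var_y}, jets0 2]"
  have "\<exists>J\<in>set ?forms. jet_equivalent 2 I J" if "jet_ideal 2 I \<and> implication_closed 2 I" for I
    using closed_ideal_equivalent[of I] that by (simp only: list.set)
  moreover have "\<exists>E. semialgebraic E \<and> (0, 0) \<in> E \<and> vanishing_ideal 2 E = J" if "J \<in> set ?forms" for J
    using that zero_is_vanishing_ideal x_is_vanishing_ideal x2_is_vanishing_ideal xy_is_vanishing_ideal
      x2_xy_is_vanishing_ideal jets0_is_vanishing_ideal
    unfolding list.set by (elim insertE emptyE) (simp_all only:)
  \<comment> \<open>These facts cover each pair of distinct ideals in both orders.\<close>
  moreover note not_equivalent = not_equivalent_linear_part not_equivalent_zero not_equivalent_x_jets0
    not_equivalent_x2 not_equivalent_xy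
  have "\<not> jet_equivalent 2 J J'" if "J \<in> set ?forms" "J' \<in> set ?forms" "J \<noteq> J'" for J J'
    using that unfolding list.set by (elim insertE emptyE) (simp_all add: not_equivalent)
  moreover have "distinct ?forms"
  proof -
    \<comment> \<open>By reflexivity, non-equivalent ideals are different, so distinctness follows
      from the same facts.\<close>
    have neq: "I \<noteq> J" if "\<not> jet_equivalent 2 I J" "I \<subseteq> jets0 2" for I J
      using that jet_equivalent_refl by blast
    show ?thesis
      unfolding distinct.simps list.set insert_iff empty_iff de_Morgan_disj
      by (intro conjI neq normal_forms_subset) (simp_all add: not_equivalent)
  qed
  ultimately show ?thesis
    unfolding Let_def by (intro conjI allI ballI impI)
qed

end
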